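(* Assume that $V\in\mathcal{C}^4(\mathbb{R}^d;\mathbb{R})$, let $x^*$ be an index-1 saddle point of $V$, and let $\alpha,\beta\in\mathbb{R}$ satisfy $\alpha+\beta>1$. Let $\Phi:\mathcal{U}\to\mathcal{U}$ be the map, defined on a neighborhood $\mathcal{U}$ of $x^*$, sending each $x\in\mathcal{U}$ to the unique local minimizer in $\mathcal{U}$ of $y\mapsto L(y;x,\alpha,\beta)$. Then the iterative scheme $x^{(k+1)}=\Phi(x^{(k)})$ has exactly the second order (local) convergence rate; that is, the iteration $x\mapsto\Phi(x)$ locally converges to $x^*$ exactly at quadratic rate.
   Context: A point $x^*$ is an index-1 saddle point of $V$ if $\nabla V(x^* )=0$ and the Hessian $\nabla^2V(x^* )$ has exactly one negative eigenvalue, all its other eigenvalues being strictly positive. For each $x$, $v(x)$ denotes the normalized eigenvector corresponding to the smallest eigenvalue of the Hessian $\nabla^2V(x)$, i.e. $v(x)=\operatorname{argmin}_{u\in\mathbb{R}^d,\,\|u\|=1}u^{T}\nabla^2V(x)u$. The function $L$ of the variable $y\in\mathbb{R}^d$ is $$L(y;x,\alpha,\beta)=(1-\alpha)V(y)+\alpha V\big(y-v(x)v(x)^{T}(y-x)\big)-\beta V\big(x+v(x)v(x)^{T}(y-x)\big).$$ The set $\mathcal{U}$ is a neighborhood of $x^*$ such that for every $x\in\mathcal{U}$ the function $y\mapsto L(y;x,\alpha,\beta)$ is strictly convex on $\mathcal{U}$ and has a unique minimum in $\mathcal{U}$, and such that $\mathcal{U}$ contains no stationary point of $V$ other than $x^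*$.
   Formalization: Quadratic convergence is proved for all V; "exactly" (one-step error not o(|x-x*|^2)) is proved if and only if D^3V(x* )[u,v(x* ),w] is nonzero for some u and some w orthogonal to v(x* ), since for quadratic V or d=1 the map sends every x to x*. *)

theory Defs
  imports "HOL-Analysis.Analysis" "HOL-Library.Landau_Symbols"
begin

primrec C_k :: "nat \<Rightarrow> ('a::real_normed_vector \<Rightarrow> 'b::real_normed_vector) \<Rightarrow> bool" where
  "C_k 0 f \<longleftrightarrow> continuous_on UNIV f"
| "C_k (Suc k) f \<longleftrightarrow>
     (\<forall>x. f differentiable (at x)) \<and> (\<forall>h. C_k k (\<lambda>x. frechet_derivative f (at x) h))"

definition gradient :: "(real^'n \<Rightarrow> real) \<Rightarrow> real^'n \<Rightarrow> real^'n" where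
  "gradient V x = (\<chi> i. frechet_derivative V (at x) (axis i 1))"

definition hessian :: "(real^'n \<Rightarrow> real) \<Rightarrow> real^'n \<Rightarrow> real^'n^'n" where
  "hessian V x = jacobian (gradient V) (at x)"

definition eigenspace :: "real^'n^'n \<Rightarrow> real \<Rightarrow> (real^'n) set" where
  "eigenspace A l = {u. A *v u = l *\<^sub>R u}"

definition eigenvalue :: "real^'n^'n \<Rightarrow> real \<Rightarrow> bool" where
  "eigenvalue A l \<longleftrightarrow> (\<exists>u \<in> eigenspace A l. u \<noteq> 0)"

(* Eigenvalues are counted with multiplicity: the negative one is simple.  For the symmetric
   matrices to which this is applied, geometric and algebraic multiplicity agree. *)
definition index1_saddle :: "(real^'n \<Rightarrow> real) \<Rightarrow> real^'n \<Rightarrow> bool" where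
  "index1_saddle V x \<longleftrightarrow>
     gradient V x = 0 \<and>
     (\<exists>l<0. eigenvalue (hessian V x) l \<and> dim (eigenspace (hessian V x) l) = 1 \<and>
        (\<forall>m. eigenvalue (hessian V x) m \<and> m \<noteq> l \<longrightarrow> m > 0))"

(* The minimizer is determined at best up to sign, so v is any selection of minimizers. *)
definition min_mode_field :: "(real^'n \<Rightarrow> real) \<Rightarrow> (real^'n \<Rightarrow> real^'n) \<Rightarrow> bool" where
  "min_mode_field V v \<longleftrightarrow>
     (\<forall>x. is_arg_min (\<lambda>u. u \<bullet> (hessian V x *v u)) (\<lambda>u. norm u = 1) (v x))"

(* (v x \<bullet> w) *\<^sub>R v x is v(x) v(x)^T w. *)
definition aux_L ::
  "(real^'n \<Rightarrow> real) \<Rightarrow> (real^'n \<Rightarrow> real^'n) \<Rightarrow> real \<Rightarrow> real \<Rightarrow> real^'n \<Rightarrow> real^'n \<Rightarrow> real" where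
  "aux_L V v \<alpha> \<beta> x y =
     (1 - \<alpha>) * V y
     + \<alpha> * V (y - (v x \<bullet> (y - x)) *\<^sub>R v x)
     - \<beta> * V (x + (v x \<bullet> (y - x)) *\<^sub>R v x)"

definition strictly_convex_on :: "'a::real_vector set \<Rightarrow> ('a \<Rightarrow> real) \<Rightarrow> bool" where
  "strictly_convex_on S f \<longleftrightarrow> convex S \<and>
     (\<forall>x\<in>S. \<forall>y\<in>S. \<forall>s>0. \<forall>t>0. x \<noteq> y \<and> s + t = 1 \<longrightarrow>
        f (s *\<^sub>R x + t *\<^sub>R y) < s * f x + t * f y)"

definition local_minimizer_in :: "'a::topological_space set \<Rightarrow> ('a \<Rightarrow> real) \<Rightarrow> 'a \<Rightarrow> bool" where
  "local_minimizer_in S f y \<longleftrightarrow> y \<in> S \<and> (\<forall>\<^sub>F z in at y within S. f y \<le> f z)"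

definition admissible_nbhd ::
  "(real^'n \<Rightarrow> real) \<Rightarrow> (real^'n \<Rightarrow> real^'n) \<Rightarrow> real \<Rightarrow> real \<Rightarrow> real^'n \<Rightarrow> (real^'n) set \<Rightarrow> bool" where
  "admissible_nbhd V v \<alpha> \<beta> xs U \<longleftrightarrow>
     xs \<in> interior U \<and>
     (\<forall>x\<in>U. strictly_convex_on U (aux_L V v \<alpha> \<beta> x) \<and>
             (\<exists>!y. is_arg_min (aux_L V v \<alpha> \<beta> x) (\<lambda>y. y \<in> U) y)) \<and>
     (\<forall>x\<in>U. gradient V x = 0 \<longrightarrow> x = xs)"

(* Meaningful for x in an admissible neighborhood U, where strict convexity makes the
   local minimizer exist uniquely. *)
definition imf_map ::
  "(real^'n \<Rightarrow> real) \<Rightarrow> (real^'n \<Rightarrow> real^'n) \<Rightarrow> real \<Rightarrow> real \<Rightarrow> (real^'n) set \<Rightarrow> real^'n \<Rightarrow> real^'n" where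
  "imf_map V v \<alpha> \<beta> U x = (THE y. local_minimizer_in U (aux_L V v \<alpha> \<beta> x) y)"

definition locally_quadratically_convergent ::
  "('a::metric_space \<Rightarrow> 'a) \<Rightarrow> 'a set \<Rightarrow> 'a \<Rightarrow> bool" where
  "locally_quadratically_convergent \<Phi> U p \<longleftrightarrow>
     (\<exists>r>0. \<exists>C. ball p r \<subseteq> U \<and>
        (\<forall>x\<in>ball p r.
           (\<forall>k. (\<Phi> ^^ k) x \<in> U) \<and>
           (\<lambda>k. (\<Phi> ^^ k) x) \<longlonglongrightarrow> p \<and>
           (\<forall>k. dist ((\<Phi> ^^ Suc k) x) p \<le> C * (dist ((\<Phi> ^^ k) x) p)\<^sup>2)))"

(* The second conjunct says that the one-step error is not o(dist^2), so the exponent 2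
   cannot be replaced by a larger one. *)
definition exactly_second_order ::
  "('a::metric_space \<Rightarrow> 'a) \<Rightarrow> 'a set \<Rightarrow> 'a \<Rightarrow> bool" where
  "exactly_second_order \<Phi> U p \<longleftrightarrow>
     locally_quadratically_convergent \<Phi> U p \<and>
     (\<lambda>x. dist (\<Phi> x) p) \<notin> o[at p](\<lambda>x. (dist x p)\<^sup>2)"

(* Some third derivative D^3 V(p)[u, v(p), w] with w orthogonal to v(p) is nonzero; equivalently,
   the derivative of x \<mapsto> v(x) v(x)^T at p is nonzero.  If all of them vanish (always in
   dimension one, or for quadratic V), the one-step error is o(dist^2), so that the scheme
   converges faster than quadratically. *)
definition nondegenerate_mode ::
  "(real^'n \<Rightarrow> real) \<Rightarrow> (real^'n \<Rightarrow> real^'n) \<Rightarrow> real^'n \<Rightarrow> bool" where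
  "nondegenerate_mode V v p \<longleftrightarrow>
     (\<exists>u w. w \<bullet> v p = 0 \<and> w \<bullet> (frechet_derivative (hessian V) (at p) u *v v p) \<noteq> 0)"

end

(* Let p be the saddle point, P = v(p) v(p)^T, and F(x, y) the gradient of y |-> L(y; x).

   Since v(x) spans an eigenline of the Hessian at x, the linear part of x |-> F(x, p) vanishes, and
   F(p + t u, p) / t^2 tends to a quadratic map Q(u) built from the third derivative of V at p.
   The derivative of y |-> F(p, y) at p acts as (1 - alpha - beta) l on v(p), where l < 0 is the
   negative eigenvalue, and as the Hessian on the orthogonal complement of v(p), so it is positive
   definite.  Compactness of the unit sphere turns these limits into bounds that are uniform for x
   near p: F(x, .) is strongly monotone and Lipschitz around p, and |F(x, p)| <= C |x - p|^2.  So the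
   minimizer y of L(.; x) satisfies F(x, y) = 0 close to p, and |y - p| is comparable to |F(x, p)|.
   This gives quadratic convergence, and the one-step error is o(|x - p|^2) iff Q = 0.  As alpha or
   beta is nonzero, this happens iff all D^3 V(p)[u, v(p), w] with w orthogonal to v(p) vanish; the
   case alpha = 0 needs a polarization. *)

theory Submission
  imports Defs
begin

text \<open>The field \<open>v\<close> is an arbitrary selection of minimizers, so it may jump
  between \<open>v x\<close> and \<open>- v x\<close>, and no differentiability of it is given. Two
  observations avoid perturbation theory of eigenvectors. Only v(x) v(x)^T enters the scheme, so
  signs may be chosen to make the field continuous at p; the gap between l and the spectrum on the
  complement provides this. And continuity is enough: the first-order terms of F(p + t u, p) are t
  H(p) w with w along v(x) or orthogonal to it. Writing H(p) = H(x) - t T u + o(t) makes v(x) an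
  exact eigenvector of the leading matrix, so the projections erase these terms without any
  expansion of v(x), and the correction - T u w ends up in Q. Limits are taken along sequences with
  converging directions and, for F(x, .), with moving x, as the contradiction arguments on the
  sphere require; hence the strict differentiability of the gradient at p. For alpha = 0 only the
  component of Q along v(p) survives. It sees D^3 V(p)[w, v(p), w] on the diagonal only, which is
  why a polarization is called for.\<close>

subsection \<open>Differential calculus with matrix-valued derivatives\<close>

lemma bounded_bilinear_matrix_vector_mult:
  "bounded_bilinear ((*v) :: real^'n^'m \<Rightarrow> real^'n \<Rightarrow> real^'m)"
  unfolding bilinear_conv_bounded_bilinear [symmetric] bilinear_def
  by (auto intro!: linearI simp: matrix_vector_mult_add_rdistrib matrix_vector_right_distrib
      matrix_vector_mult_scaleR scaleR_matrix_vector_assoc)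

lemmas tendsto_matrix_vector_mult [tendsto_intros] =
  bounded_bilinear.tendsto [OF bounded_bilinear_matrix_vector_mult]

lemma norm_matrix_vector_mult_le:
  fixes A :: "real^'n^'m"
  obtains K where "K > 0" "\<And>(A :: real^'n^'m) x. norm (A *v x) \<le> norm A * norm x * K"
  using bounded_bilinear.pos_bounded [OF bounded_bilinear_matrix_vector_mult] by blast

text \<open>Components range over a Euclidean space rather than the reals, so that the rows of a
  matrix count as components and the lemma can be applied twice to the Hessian.\<close>

lemma differentiable_vecI:
  fixes f :: "'a::real_normed_vector \<Rightarrow> 'b::euclidean_space^'n"
  assumes "\<And>i. (\<lambda>x. f x $ i) differentiable (at x)"
  shows "f differentiable (at x)"
proof -
  have lin: "bounded_linear (axis i :: 'b \<Rightarrow> 'b^'n)" for i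
    by (intro linear_conv_bounded_linear[THEN iffD1] linearI) (auto simp: axis_def vec_eq_iff)
  have "f = (\<lambda>x. \<Sum>i\<in>UNIV. axis i (f x $ i))"
    by (rule ext, simp add: vec_eq_iff axis_def if_distrib sum.delta cong: if_cong)
  moreover have "(\<lambda>x. \<Sum>i\<in>UNIV. axis i (f x $ i)) differentiable (at x)"
  proof (intro differentiable_sum ballI)
    show "(\<lambda>x. axis i (f x $ i)) differentiable (at x)" for i
      using bounded_linear.has_derivative[OF lin] assms[of i] unfolding differentiable_def by blast
  qed auto
  ultimately show ?thesis by simp
qed

text \<open>Strict differentiability at \<open>p\<close>: the mean value inequality is applied to
  \<open>f\<close> minus its linearization, whose derivative \<open>H z - H p\<close> is small near
  \<open>p\<close>. Both endpoints are free, which a derivative at \<open>p\<close> alone does not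
  give.\<close>

lemma has_derivative_linearization_bound:
  fixes f :: "real^'n \<Rightarrow> real^'m"
  assumes f': "\<And>x. (f has_derivative (\<lambda>h. H x *v h)) (at x)"
    and cont: "isCont H p" and "\<epsilon> > 0"
  obtains \<delta> where "\<delta> > 0"
    "\<And>x y. x \<in> ball p \<delta> \<Longrightarrow> y \<in> ball p \<delta> \<Longrightarrow>
       norm (f y - f x - H p *v (y - x)) \<le> \<epsilon> * norm (y - x)"
proof -
  obtain K where K: "K > 0" "\<And>(A::real^'n^'m) x. norm (A *v x) \<le> norm A * norm x * K"
    using norm_matrix_vector_mult_le by blast
  obtain \<delta> where \<delta>: "\<delta> > 0" "\<And>x. x \<in> ball p \<delta> \<Longrightarrow> norm (H x - H p) < \<epsilon> / K"
    using cont \<open>\<epsilon> > 0\<close> K(1) unfolding continuous_at_eps_delta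
    by (metis dist_commute dist_norm divide_pos_pos mem_ball)
  show ?thesis
  proof
    fix x y assume xy: "x \<in> ball p \<delta>" "y \<in> ball p \<delta>"
    have "norm ((f y - H p *v y) - (f x - H p *v x)) \<le> \<epsilon> * norm (y - x)"
    proof (rule differentiable_bound [where S="ball p \<delta>"
          and f="\<lambda>z. f z - H p *v z" and f'="\<lambda>z h. H z *v h - H p *v h"])
      fix z assume z: "z \<in> ball p \<delta>"
      show "((\<lambda>z. f z - H p *v z) has_derivative (\<lambda>h. H z *v h - H p *v h)) (at z within ball p \<delta>)"
        by (intro derivative_intros has_derivative_at_withinI[OF f']
            bounded_linear_imp_has_derivative matrix_vector_mul_bounded_linear)
      have "norm (H z *v h - H p *v h) \<le> \<epsilon> * norm h" for h
      proof -
        have "norm (H z *v h - H p *v h) \<le> norm (H z - H p) * norm h * K"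
          by (metis K(2) matrix_vector_mult_diff_rdistrib)
        also have "\<dots> \<le> (\<epsilon> / K) * norm h * K"
          using \<delta>(2)[OF z] K(1) by (intro mult_right_mono) auto
        finally show ?thesis using K(1) by simp
      qed
      then show "onorm (\<lambda>h. H z *v h - H p *v h) \<le> \<epsilon>" by (rule onorm_le)
    qed (use xy in auto)
    then show "norm (f y - f x - H p *v (y - x)) \<le> \<epsilon> * norm (y - x)"
      by (simp add: matrix_vector_mult_diff_distrib algebra_simps)
  qed (fact \<delta>(1))
qed

lemma norm_scaleR_inverse_le:
  fixes x :: "'a::real_normed_vector"
  assumes "norm x \<le> B" "t > 0"
  shows "norm (x /\<^sub>R t) \<le> B / t"
  using assms by (simp add: divide_inverse_commute)

text \<open>The base points \<open>a n\<close> move while the increments shrink. This is the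
  situation of the projected points at which the gradient is evaluated, since these depend on the
  current iterate.\<close>

lemma tendsto_strict_difference_quotient:
  fixes f :: "real^'n \<Rightarrow> real^'m"
  assumes f': "\<And>x. (f has_derivative (\<lambda>h. H x *v h)) (at x)"
    and cont: "isCont H p"
    and a: "a \<longlonglongrightarrow> p" and t: "t \<longlonglongrightarrow> 0" "\<And>n::nat. t n > (0::real)" and w: "w \<longlonglongrightarrow> w0"
  shows "(\<lambda>n. (f (a n + t n *\<^sub>R w n) - f (a n)) /\<^sub>R t n) \<longlonglongrightarrow> H p *v w0"
proof -
  have b: "(\<lambda>n. a n + t n *\<^sub>R w n) \<longlonglongrightarrow> p"
    using tendsto_add[OF a tendsto_scaleR[OF t(1) w]] by simp
  have "(\<lambda>n. (f (a n + t n *\<^sub>R w n) - f (a n)) /\<^sub>R t n - H p *v w n) \<longlonglongrightarrow> 0"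
  proof (rule metric_LIMSEQ_I)
    fix e :: real assume "e > 0"
    have "norm w0 + 1 > 0" by (simp add: add_nonneg_pos)
    define \<epsilon> where "\<epsilon> = e / (norm w0 + 1)"
    have "\<epsilon> > 0" using \<open>e > 0\<close> \<open>norm w0 + 1 > 0\<close> by (simp add: \<epsilon>_def)
    obtain \<delta> where \<delta>: "\<delta> > 0" "\<And>x y. x \<in> ball p \<delta> \<Longrightarrow> y \<in> ball p \<delta> \<Longrightarrow>
       norm (f y - f x - H p *v (y - x)) \<le> \<epsilon> * norm (y - x)"
      using has_derivative_linearization_bound[OF f' cont \<open>\<epsilon> > 0\<close>] by blast
    have "\<forall>\<^sub>F n in sequentially. a n \<in> ball p \<delta> \<and> a n + t n *\<^sub>R w n \<in> ball p \<delta> \<and> norm (w n) < norm w0 + 1"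
      using tendstoD[OF a \<delta>(1)] tendstoD[OF b \<delta>(1)] order_tendstoD(2)[OF tendsto_norm[OF w] less_add_one]
      by eventually_elim (auto simp: dist_commute)
    then have "\<forall>\<^sub>F n in sequentially. dist ((f (a n + t n *\<^sub>R w n) - f (a n)) /\<^sub>R t n - H p *v w n) 0 < e"
    proof eventually_elim
      case (elim n)
      have "(f (a n + t n *\<^sub>R w n) - f (a n)) /\<^sub>R t n - H p *v w n =
          (f (a n + t n *\<^sub>R w n) - f (a n) - H p *v ((a n + t n *\<^sub>R w n) - a n)) /\<^sub>R t n"
        using t(2)[of n] by (simp add: matrix_vector_mult_scaleR scaleR_right_diff_distrib)
      also have "norm \<dots> \<le> (\<epsilon> * norm ((a n + t n *\<^sub>R w n) - a n)) / t n"
        using elim t(2)[of n] by (intro norm_scaleR_inverse_le \<delta>(2)) auto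
      also have "\<dots> = \<epsilon> * norm (w n)" using t(2)[of n] by simp
      also have "\<dots> < \<epsilon> * (norm w0 + 1)" using elim \<open>\<epsilon> > 0\<close> by simp
      also have "\<dots> = e" using \<open>norm w0 + 1 > 0\<close> by (simp add: \<epsilon>_def)
      finally show ?case by simp
    qed
    then show "\<exists>no. \<forall>n\<ge>no. dist ((f (a n + t n *\<^sub>R w n) - f (a n)) /\<^sub>R t n - H p *v w n) 0 < e"
      by (simp add: eventually_sequentially)
  qed
  moreover have "(\<lambda>n. H p *v w n) \<longlonglongrightarrow> H p *v w0" by (intro tendsto_intros w)
  ultimately show ?thesis using tendsto_add by fastforce
qed

text \<open>The remainder has derivative \<open>H (p + y) - H p - T y\<close>, because symmetry of
  \<open>T\<close> merges the two halves of the derivative of the quadratic term. This is o(|y|) by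
  differentiability of \<open>H\<close> at \<open>p\<close>.\<close>

lemma second_order_taylor_bound:
  fixes f :: "real^'n \<Rightarrow> real^'m"
  assumes f': "\<And>x. (f has_derivative (\<lambda>h. H x *v h)) (at x)"
    and H': "(H has_derivative T) (at p)"
    and T_sym: "\<And>u w. T u *v w = T w *v u"
    and "\<epsilon> > 0"
  obtains \<delta> where "\<delta> > 0"
    "\<And>z. norm z < \<delta> \<Longrightarrow>
       norm (f (p + z) - f p - H p *v z - (1/2) *\<^sub>R (T z *v z)) \<le> \<epsilon> * (norm z)\<^sup>2"
proof -
  obtain K where K: "K > 0" "\<And>(A::real^'n^'m) x. norm (A *v x) \<le> norm A * norm x * K"
    using norm_matrix_vector_mult_le by blast
  interpret T: bounded_linear T using H' by (rule has_derivative_bounded_linear)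
  obtain \<delta> where \<delta>: "\<delta> > 0" "\<And>z. norm z < \<delta> \<Longrightarrow> norm (H (p + z) - H p - T z) \<le> \<epsilon> / K * norm z"
  proof -
    have "\<epsilon> / K > 0" using \<open>\<epsilon> > 0\<close> K(1) by simp
    then obtain d where d: "d > 0" "\<And>y. norm (y - p) < d \<Longrightarrow> norm (H y - H p - T (y - p)) \<le> \<epsilon> / K * norm (y - p)"
      using H' unfolding has_derivative_at_alt by blast
    have "norm (H (p + z) - H p - T z) \<le> \<epsilon> / K * norm z" if "norm z < d" for z
      using d(2)[of "p + z"] that by simp
    then show ?thesis using that d(1) by blast
  qed
  show ?thesis
  proof
    fix z :: "real^'n" assume z: "norm z < \<delta>"
    define R where "R = (\<lambda>y. f (p + y) - H p *v y - (1/2) *\<^sub>R (T y *v y))"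
    \<comment> \<open>On the ball of radius \<open>norm z\<close> the derivative is at most
      \<open>\<epsilon> * norm z\<close>; the mean value inequality supplies the second factor
      \<open>norm z\<close>.\<close>
    have "norm (R z - R 0) \<le> (\<epsilon> * norm z) * norm (z - 0)"
    proof (rule differentiable_bound [where S="cball 0 (norm z)"
          and f'="\<lambda>y h. H (p + y) *v h - H p *v h - T y *v h"])
      fix y :: "real^'n" assume y: "y \<in> cball 0 (norm z)"
      have 1: "((\<lambda>y. f (p + y)) has_derivative (\<lambda>h. H (p + y) *v h)) (at y)"
        using has_derivative_compose[OF has_derivative_add[OF has_derivative_const has_derivative_ident] f', of p y UNIV]
        by simp
      have 2: "((\<lambda>y. T y *v y) has_derivative (\<lambda>h. T y *v h + T h *v y)) (at y)"
        by (intro bounded_bilinear.FDERIV[OF bounded_bilinear_matrix_vector_mult]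
            bounded_linear_imp_has_derivative T.bounded_linear_axioms has_derivative_ident)
      have "(R has_derivative (\<lambda>h. H (p + y) *v h - H p *v h - (1/2) *\<^sub>R (T y *v h + T h *v y))) (at y)"
        unfolding R_def
        by (intro has_derivative_diff 1 has_derivative_scaleR_right 2
            bounded_linear_imp_has_derivative matrix_vector_mul_bounded_linear)
      moreover have "(1/2) *\<^sub>R (T y *v h + T h *v y) = T y *v h" for h
        unfolding T_sym[of h y] by (simp flip: scaleR_2)
      ultimately show "(R has_derivative (\<lambda>h. H (p + y) *v h - H p *v h - T y *v h)) (at y within cball 0 (norm z))"
        by (simp add: has_derivative_at_withinI)
      have "norm (H (p + y) *v h - H p *v h - T y *v h) \<le> \<epsilon> * norm z * norm h" for h
      proof -
        have "norm (H (p + y) *v h - H p *v h - T y *v h) \<le> norm (H (p + y) - H p - T y) * norm h * K"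
          by (metis K(2) matrix_vector_mult_diff_rdistrib)
        also have "\<dots> \<le> (\<epsilon> / K * norm z) * norm h * K"
        proof (intro mult_right_mono)
          have "norm (H (p + y) - H p - T y) \<le> \<epsilon> / K * norm y" using \<delta>(2)[of y] y z by simp
          also have "\<dots> \<le> \<epsilon> / K * norm z" using y \<open>\<epsilon> > 0\<close> K(1) by (intro mult_left_mono) auto
          finally show "norm (H (p + y) - H p - T y) \<le> \<epsilon> / K * norm z" .
        qed (use K(1) in auto)
        finally show ?thesis using K(1) by simp
      qed
      then show "onorm (\<lambda>h. H (p + y) *v h - H p *v h - T y *v h) \<le> \<epsilon> * norm z" by (rule onorm_le)
    qed auto
    then show "norm (f (p + z) - f p - H p *v z - (1/2) *\<^sub>R (T z *v z)) \<le> \<epsilon> * (norm z)\<^sup>2"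
      by (simp add: R_def T.zero algebra_simps power2_eq_square)
  qed (fact \<delta>(1))
qed

lemma tendsto_second_order_taylor:
  fixes f :: "real^'n \<Rightarrow> real^'m"
  assumes f': "\<And>x. (f has_derivative (\<lambda>h. H x *v h)) (at x)"
    and H': "(H has_derivative T) (at p)"
    and T_sym: "\<And>u w. T u *v w = T w *v u"
    and t: "t \<longlonglongrightarrow> 0" "\<And>n::nat. t n > (0::real)" and w: "w \<longlonglongrightarrow> w0"
  shows "(\<lambda>n. (f (p + t n *\<^sub>R w n) - f p - H p *v (t n *\<^sub>R w n)) /\<^sub>R (t n)\<^sup>2)
           \<longlonglongrightarrow> (1/2) *\<^sub>R (T w0 *v w0)"
proof -
  interpret T: bounded_linear T using H' by (rule has_derivative_bounded_linear)
  have b: "(\<lambda>n. t n *\<^sub>R w n) \<longlonglongrightarrow> 0" using tendsto_scaleR[OF t(1) w] by simp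
  have "(\<lambda>n. (f (p + t n *\<^sub>R w n) - f p - H p *v (t n *\<^sub>R w n)) /\<^sub>R (t n)\<^sup>2 - (1/2) *\<^sub>R (T (w n) *v w n)) \<longlonglongrightarrow> 0"
    (is "?X \<longlonglongrightarrow> 0")
  proof (rule metric_LIMSEQ_I)
    fix e :: real assume "e > 0"
    define N where "N = norm w0 + 1"
    have N: "N > 0" by (simp add: add_nonneg_pos N_def)
    define \<epsilon> where "\<epsilon> = e / (2 * N\<^sup>2)"
    have "\<epsilon> > 0" using \<open>e > 0\<close> N by (simp add: \<epsilon>_def)
    obtain \<delta> where \<delta>: "\<delta> > 0" "\<And>z. norm z < \<delta> \<Longrightarrow>
       norm (f (p + z) - f p - H p *v z - (1/2) *\<^sub>R (T z *v z)) \<le> \<epsilon> * (norm z)\<^sup>2"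
      using second_order_taylor_bound[OF f' H' T_sym \<open>\<epsilon> > 0\<close>] by blast
    have "\<forall>\<^sub>F n in sequentially. norm (t n *\<^sub>R w n) < \<delta> \<and> norm (w n) < N"
      using tendstoD[OF b \<delta>(1)] order_tendstoD(2)[OF tendsto_norm[OF w] less_add_one]
      by eventually_elim (auto simp: N_def)
    then have "\<forall>\<^sub>F n in sequentially. dist (?X n) 0 < e"
    proof eventually_elim
      case (elim n)
      have quad: "T (t n *\<^sub>R w n) *v (t n *\<^sub>R w n) = (t n)\<^sup>2 *\<^sub>R (T (w n) *v w n)"
        by (simp add: T.scaleR matrix_vector_mult_scaleR power2_eq_square flip: scaleR_matrix_vector_assoc)
      have "?X n = (f (p + t n *\<^sub>R w n) - f p - H p *v (t n *\<^sub>R w n) - (1/2) *\<^sub>R (T (t n *\<^sub>R w n) *v (t n *\<^sub>R w n))) /\<^sub>R (t n)\<^sup>2"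
        unfolding quad scaleR_right_diff_distrib using t(2)[of n] by simp
      also have "norm \<dots> \<le> (\<epsilon> * (norm (t n *\<^sub>R w n))\<^sup>2) / (t n)\<^sup>2"
        using elim t(2)[of n] by (intro norm_scaleR_inverse_le \<delta>(2)) auto
      also have "\<dots> = \<epsilon> * (norm (w n))\<^sup>2" using t(2)[of n] by (simp add: power_mult_distrib)
      also have "\<dots> \<le> \<epsilon> * N\<^sup>2"
        using elim \<open>\<epsilon> > 0\<close> by (intro mult_left_mono power_mono) auto
      also have "\<dots> < e" using N \<open>e > 0\<close> by (simp add: \<epsilon>_def)
      finally show ?case by simp
    qed
    then show "\<exists>no. \<forall>n\<ge>no. dist (?X n) 0 < e"
      by (simp add: eventually_sequentially)
  qed
  moreover have "(\<lambda>n. (1/2) *\<^sub>R (T (w n) *v w n)) \<longlonglongrightarrow> (1/2) *\<^sub>R (T w0 *v w0)"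
    by (intro tendsto_intros T.tendsto w)
  ultimately show ?thesis using tendsto_add by fastforce
qed

text \<open>Schwarz's theorem at a point: the second difference of \<open>f\<close> over the
  parallelogram spanned by t h and t k is symmetric in \<open>h\<close> and \<open>k\<close>, and
  equals t^2 (A k \<bullet> h) up to o(t^2).\<close>

lemma derivative_of_gradient_symmetric:
  fixes f :: "real^'n \<Rightarrow> real"
  assumes f': "\<And>x. (f has_derivative (\<lambda>h. g x \<bullet> h)) (at x)"
    and g': "(g has_derivative (\<lambda>h. A *v h)) (at p)"
  shows "(A *v h) \<bullet> k = h \<bullet> (A *v k)"
proof -
  have key: "\<exists>\<delta>>0. \<forall>t h k. 0 < t \<and> t * (norm h + norm k) < \<delta> \<longrightarrow>
      \<bar>(f (p + t *\<^sub>R h + t *\<^sub>R k) - f (p + t *\<^sub>R h) - f (p + t *\<^sub>R k) + f p) - t\<^sup>2 * ((A *v k) \<bullet> h)\<bar>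
        \<le> 2 * \<epsilon> * t\<^sup>2 * (norm h + norm k)\<^sup>2" if "\<epsilon> > 0" for \<epsilon>
  proof -
    obtain \<delta> where \<delta>: "\<delta> > 0" "\<And>y. norm (y - p) < \<delta> \<Longrightarrow> norm (g y - g p - A *v (y - p)) \<le> \<epsilon> * norm (y - p)"
      using g' \<open>\<epsilon> > 0\<close> unfolding has_derivative_at_alt by blast
    have "\<bar>(f (p + t *\<^sub>R h + t *\<^sub>R k) - f (p + t *\<^sub>R h) - f (p + t *\<^sub>R k) + f p) - t\<^sup>2 * ((A *v k) \<bullet> h)\<bar>
        \<le> 2 * \<epsilon> * t\<^sup>2 * (norm h + norm k)\<^sup>2" if t: "0 < t" "t * (norm h + norm k) < \<delta>" for t h k
    proof -
      \<comment> \<open>\<open>\<phi> (t *\<^sub>R h) - \<phi> 0\<close> is the second difference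
        minus its expected value. The derivative of \<open>\<phi>\<close> is a difference of two
        linearization errors of \<open>g\<close>, at y + t k and at y, hence the factor 2.\<close>
      define \<phi> where "\<phi> = (\<lambda>y. f (p + y + t *\<^sub>R k) - f (p + y) - (A *v (t *\<^sub>R k)) \<bullet> y)"
      define s where "s = norm h + norm k"
      have "norm (\<phi> (t *\<^sub>R h) - \<phi> 0) \<le> (2 * \<epsilon> * (t * s)) * norm (t *\<^sub>R h - 0)"
      proof (rule differentiable_bound [where S="cball 0 (norm (t *\<^sub>R h))"
            and f'="\<lambda>y d. g (p + y + t *\<^sub>R k) \<bullet> d - g (p + y) \<bullet> d - (A *v (t *\<^sub>R k)) \<bullet> d"])
        fix y :: "real^'n" assume y: "y \<in> cball 0 (norm (t *\<^sub>R h))"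
        have 1: "((\<lambda>y. f (c + y)) has_derivative (\<lambda>h. g (c + y) \<bullet> h)) (at y)" for c
          using has_derivative_compose[OF has_derivative_add[OF has_derivative_const has_derivative_ident] f', of c y UNIV]
          by simp
        have 2: "((\<lambda>y. f (p + y + t *\<^sub>R k)) has_derivative (\<lambda>h. g (p + y + t *\<^sub>R k) \<bullet> h)) (at y)"
          using 1[of "p + t *\<^sub>R k"] by (simp add: add_ac)
        have "(\<phi> has_derivative (\<lambda>d. g (p + y + t *\<^sub>R k) \<bullet> d - g (p + y) \<bullet> d - (A *v (t *\<^sub>R k)) \<bullet> d)) (at y)"
          unfolding \<phi>_def
          by (intro has_derivative_diff 1 2 has_derivative_inner_right has_derivative_ident)
        then show "(\<phi> has_derivative (\<lambda>d. g (p + y + t *\<^sub>R k) \<bullet> d - g (p + y) \<bullet> d - (A *v (t *\<^sub>R k)) \<bullet> d))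
            (at y within cball 0 (norm (t *\<^sub>R h)))" by (rule has_derivative_at_withinI)
        have ny: "norm y \<le> t * norm h" using y t(1) by simp
        have ny2: "norm (y + t *\<^sub>R k) \<le> t * s"
          using norm_triangle_ineq[of y "t *\<^sub>R k"] ny t(1) by (simp add: s_def distrib_left)
        have ny1: "norm y \<le> t * s"
          using ny t(1) by (simp add: s_def distrib_left add_increasing2)
        have ts: "t * s < \<delta>" using t(2) by (simp add: s_def)
        have "norm (g (p + y + t *\<^sub>R k) - g (p + y) - A *v (t *\<^sub>R k)) \<le> 2 * \<epsilon> * (t * s)"
        proof -
          have "g (p + y + t *\<^sub>R k) - g (p + y) - A *v (t *\<^sub>R k) =
             (g (p + (y + t *\<^sub>R k)) - g p - A *v (y + t *\<^sub>R k)) - (g (p + y) - g p - A *v y)"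
            by (simp add: matrix_vector_right_distrib algebra_simps)
          also have "norm \<dots> \<le> \<epsilon> * norm (y + t *\<^sub>R k) + \<epsilon> * norm y"
            using \<delta>(2)[of "p + (y + t *\<^sub>R k)"] \<delta>(2)[of "p + y"] ny1 ny2 ts
              norm_triangle_ineq4[of "g (p + (y + t *\<^sub>R k)) - g p - A *v (y + t *\<^sub>R k)" "g (p + y) - g p - A *v y"]
            by auto
          also have "\<dots> \<le> \<epsilon> * (t * s) + \<epsilon> * (t * s)"
            using ny1 ny2 \<open>\<epsilon> > 0\<close> by (intro add_mono mult_left_mono) auto
          finally show ?thesis by (simp add: mult_ac)
        qed
        then have "norm (g (p + y + t *\<^sub>R k) \<bullet> d - g (p + y) \<bullet> d - (A *v (t *\<^sub>R k)) \<bullet> d) \<le> 2 * \<epsilon> * (t * s) * norm d" for d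
          unfolding inner_diff_left[symmetric] real_norm_def
          by (meson Cauchy_Schwarz_ineq2 mult_right_mono norm_ge_zero order_trans)
        then show "onorm (\<lambda>d. g (p + y + t *\<^sub>R k) \<bullet> d - g (p + y) \<bullet> d - (A *v (t *\<^sub>R k)) \<bullet> d) \<le> 2 * \<epsilon> * (t * s)"
          by (rule onorm_le)
      qed auto
      also have "\<dots> \<le> (2 * \<epsilon> * (t * s)) * (t * s)"
        using t(1) \<open>\<epsilon> > 0\<close> by (intro mult_left_mono) (auto simp: s_def)
      finally show ?thesis
        by (simp add: \<phi>_def matrix_vector_mult_scaleR power2_eq_square algebra_simps s_def)
    qed
    then show ?thesis using \<delta>(1) by blast
  qed
  define s where "s = norm h + norm k"
  \<comment> \<open>Exchanging \<open>h\<close> and \<open>k\<close> fixes the second difference, so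
    the two expected values differ by at most twice the error.\<close>
  have bound: "\<bar>(A *v k) \<bullet> h - (A *v h) \<bullet> k\<bar> \<le> 4 * \<epsilon> * s\<^sup>2" if eps: "\<epsilon> > 0" for \<epsilon>
  proof -
    obtain \<delta> where \<delta>: "\<delta> > 0" "\<And>t h k. 0 < t \<Longrightarrow> t * (norm h + norm k) < \<delta> \<Longrightarrow>
      \<bar>(f (p + t *\<^sub>R h + t *\<^sub>R k) - f (p + t *\<^sub>R h) - f (p + t *\<^sub>R k) + f p) - t\<^sup>2 * ((A *v k) \<bullet> h)\<bar>
        \<le> 2 * \<epsilon> * t\<^sup>2 * (norm h + norm k)\<^sup>2" using key[OF eps] by blast
    \<comment> \<open>The added 1 keeps the denominator positive when \<open>h\<close> and
      \<open>k\<close> are both 0.\<close>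
    define t where "t = \<delta> / (2 * (s + 1))"
    have s: "s \<ge> 0" by (simp add: s_def)
    have t: "t > 0" using \<delta>(1) s by (simp add: t_def)
    have ts: "t * s < \<delta>" using \<delta>(1) s by (simp add: t_def field_simps add_nonneg_pos)
    let ?\<Delta> = "f (p + t *\<^sub>R h + t *\<^sub>R k) - f (p + t *\<^sub>R h) - f (p + t *\<^sub>R k) + f p"
    have "\<bar>?\<Delta> - t\<^sup>2 * ((A *v k) \<bullet> h)\<bar> \<le> 2 * \<epsilon> * t\<^sup>2 * s\<^sup>2"
      using \<delta>(2)[of t h k] t ts by (simp add: s_def)
    moreover have "\<bar>?\<Delta> - t\<^sup>2 * ((A *v h) \<bullet> k)\<bar> \<le> 2 * \<epsilon> * t\<^sup>2 * s\<^sup>2"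
      using \<delta>(2)[of t k h] t ts by (simp add: s_def add_ac)
    ultimately have "\<bar>t\<^sup>2 * ((A *v k) \<bullet> h) - t\<^sup>2 * ((A *v h) \<bullet> k)\<bar> \<le> 2 * (2 * \<epsilon> * t\<^sup>2 * s\<^sup>2)" by linarith
    moreover have "t\<^sup>2 * \<bar>(A *v k) \<bullet> h - (A *v h) \<bullet> k\<bar> = \<bar>t\<^sup>2 * ((A *v k) \<bullet> h) - t\<^sup>2 * ((A *v h) \<bullet> k)\<bar>"
      by (simp add: abs_mult flip: right_diff_distrib)
    ultimately have "t\<^sup>2 * \<bar>(A *v k) \<bullet> h - (A *v h) \<bullet> k\<bar> \<le> t\<^sup>2 * (4 * \<epsilon> * s\<^sup>2)"
      by (simp add: mult_ac)
    then show ?thesis using t by (simp only: mult_le_cancel_left_pos zero_less_power)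
  qed
  have "\<bar>(A *v k) \<bullet> h - (A *v h) \<bullet> k\<bar> \<le> 0"
  proof (rule field_le_epsilon)
    fix e :: real assume "e > 0"
    define D where "D = s\<^sup>2 + 1"
    have D: "D > 0" "s\<^sup>2 \<le> D" by (auto simp: D_def add_nonneg_pos)
    have "\<bar>(A *v k) \<bullet> h - (A *v h) \<bullet> k\<bar> \<le> 4 * (e / (4 * D)) * s\<^sup>2"
      using \<open>e > 0\<close> D by (intro bound) simp
    also have "\<dots> = e * (s\<^sup>2 / D)" by simp
    also have "\<dots> \<le> e * 1" using \<open>e > 0\<close> D by (intro mult_left_mono) auto
    finally show "\<bar>(A *v k) \<bullet> h - (A *v h) \<bullet> k\<bar> \<le> 0 + e" by simp
  qed
  then show ?thesis by (simp add: inner_commute)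
qed

subsection \<open>Gradients and Hessians of functions of class C4\<close>

lemma C_k_Suc_imp_differentiable: "C_k (Suc k) f \<Longrightarrow> f differentiable (at x)"
  by simp

lemma has_derivative_gradient:
  assumes "V differentiable (at x)"
  shows "(V has_derivative (\<lambda>h. gradient V x \<bullet> h)) (at x)"
proof -
  have D: "(V has_derivative frechet_derivative V (at x)) (at x)"
    using assms by (simp add: frechet_derivative_works)
  interpret D: bounded_linear "frechet_derivative V (at x)"
    using D by (rule has_derivative_bounded_linear)
  have "frechet_derivative V (at x) h = gradient V x \<bullet> h" for h
  proof -
    have "h = (\<Sum>i\<in>UNIV. h $ i *\<^sub>R axis i 1)"
      unfolding scalar_mult_eq_scaleR[symmetric] by (rule basis_expansion[symmetric])
    moreover have "frechet_derivative V (at x) (\<Sum>i\<in>UNIV. h $ i *\<^sub>R axis i 1) =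
        (\<Sum>i\<in>UNIV. h $ i * frechet_derivative V (at x) (axis i 1))"
      by (simp add: D.sum D.scaleR)
    ultimately have "frechet_derivative V (at x) h = (\<Sum>i\<in>UNIV. h $ i * frechet_derivative V (at x) (axis i 1))"
      by simp
    then show ?thesis by (simp add: gradient_def inner_vec_def mult.commute)
  qed
  then have "frechet_derivative V (at x) = (\<lambda>h. gradient V x \<bullet> h)" by (rule ext)
  with D show ?thesis by simp
qed

lemma gradient_differentiable:
  assumes "C_k (Suc (Suc k)) V"
  shows "gradient V differentiable (at x)"
proof (rule differentiable_vecI)
  show "(\<lambda>x. gradient V x $ i) differentiable (at x)" for i
    using assms by (simp add: gradient_def)
qed

lemma has_derivative_hessian:
  assumes "C_k (Suc (Suc k)) V"
  shows "(gradient V has_derivative (\<lambda>h. hessian V x *v h)) (at x)"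
  using gradient_differentiable[OF assms] by (simp add: hessian_def jacobian_works)

text \<open>\<open>C_k\<close> speaks of iterated directional derivatives; the entries of the
  Hessian are identified with those along the axes.\<close>

lemma hessian_differentiable:
  assumes "C_k (Suc (Suc (Suc k))) V"
  shows "hessian V differentiable (at x)"
proof (intro differentiable_vecI)
  fix i j
  have "hessian V x $ i $ j = frechet_derivative (\<lambda>x. frechet_derivative V (at x) (axis i 1)) (at x) (axis j 1)" for x
  proof -
    have "((\<lambda>y. gradient V y $ i) has_derivative (\<lambda>h. (hessian V x *v h) $ i)) (at x)"
      using bounded_linear.has_derivative[OF bounded_linear_vec_nth has_derivative_hessian[OF assms]] .
    then have "(\<lambda>h. (hessian V x *v h) $ i) = frechet_derivative (\<lambda>y. gradient V y $ i) (at x)"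
      by (rule frechet_derivative_at)
    then have "(hessian V x *v axis j 1) $ i = frechet_derivative (\<lambda>y. gradient V y $ i) (at x) (axis j 1)"
      by metis
    then show ?thesis by (simp add: gradient_def matrix_vector_mult_basis column_def)
  qed
  then show "(\<lambda>x. hessian V x $ i $ j) differentiable (at x)"
    using assms by simp
qed

lemma hessian_symmetric:
  assumes "C_k (Suc (Suc k)) V"
  shows "(hessian V x *v h) \<bullet> w = h \<bullet> (hessian V x *v w)"
proof (rule derivative_of_gradient_symmetric)
  show "(V has_derivative (\<lambda>h. gradient V x \<bullet> h)) (at x)" for x
    using assms by (intro has_derivative_gradient) simp
qed (rule has_derivative_hessian[OF assms])

text \<open>The trilinear form \<open>(T u *v h) \<bullet> w\<close> is invariant under exchange of
  its last two slots, by symmetry of each Hessian, and of its first and third, by Schwarz's theorem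
  for a directional derivative of \<open>V\<close>. These exchanges generate all
  permutations.\<close>

lemma hessian_derivative_symmetric:
  assumes "C_k 4 V" and T: "(hessian V has_derivative T) (at p)"
  shows "(T u *v h) \<bullet> w = h \<bullet> (T u *v w)" and "T u *v w = T w *v u"
proof -
  have C: "C_k (Suc (Suc (Suc (Suc 0)))) V" using assms(1) by (simp add: numeral_eq_Suc del: C_k.simps)
  have Tb: "((\<lambda>x. hessian V x *v h) has_derivative (\<lambda>u. T u *v h)) (at p)" for h
    using bounded_linear.has_derivative[OF
        bounded_bilinear.bounded_linear_left[OF bounded_bilinear_matrix_vector_mult] T] .
  have sym: "(T u *v h) \<bullet> w = h \<bullet> (T u *v w)" for u h w
  proof -
    have "((\<lambda>x. (hessian V x *v h) \<bullet> w) has_derivative (\<lambda>u. (T u *v h) \<bullet> w)) (at p)"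
      by (intro has_derivative_inner_left Tb)
    moreover have "((\<lambda>x. (hessian V x *v h) \<bullet> w) has_derivative (\<lambda>u. h \<bullet> (T u *v w))) (at p)"
      unfolding hessian_symmetric[OF C] by (intro has_derivative_inner_right Tb)
    ultimately show ?thesis using has_derivative_unique by (metis (no_types, lifting))
  qed
  then show "(T u *v h) \<bullet> w = h \<bullet> (T u *v w)" .
  \<comment> \<open>The gradient of \<open>x \<mapsto> gradient V x \<bullet> w\<close> is \<open>hessian V x *v w\<close>, whose derivative
    is therefore symmetric as well.\<close>
  have swap: "(T h *v w) \<bullet> k = h \<bullet> (T k *v w)" for h k w
  proof -
    have lin: "linear T" using T by (rule has_derivative_linear)
    have lw: "linear (\<lambda>u. T u *v w)"
      by (intro linearI) (auto simp: linear_add[OF lin] linear_cmul[OF lin] matrix_vector_mult_add_rdistrib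
          scaleR_matrix_vector_assoc)
    obtain M where M: "M *v u = T u *v w" for u
      using matrix_vector_mul(2)[OF lw] by metis
    have "(M *v h) \<bullet> k = h \<bullet> (M *v k)"
    proof (rule derivative_of_gradient_symmetric[where f="\<lambda>x. gradient V x \<bullet> w" and g="\<lambda>x. hessian V x *v w"])
      show "((\<lambda>x. gradient V x \<bullet> w) has_derivative (\<lambda>h. (hessian V x *v w) \<bullet> h)) (at x)" for x
      proof -
        have "(\<lambda>h. (hessian V x *v w) \<bullet> h) = (\<lambda>h. (hessian V x *v h) \<bullet> w)"
          using hessian_symmetric[OF C, of x] by (metis inner_commute)
        then show ?thesis
          using has_derivative_inner_left[OF has_derivative_hessian[OF C], of w x] by simp
      qed
      show "((\<lambda>x. hessian V x *v w) has_derivative (*v) M) (at p)"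
      proof -
        have "(*v) M = (\<lambda>u. T u *v w)" by (rule ext) (rule M)
        then show ?thesis using Tb by simp
      qed
    qed
    then show ?thesis by (simp add: M)
  qed
  have "(T u *v w) \<bullet> k = (T w *v u) \<bullet> k" for k
    by (metis inner_commute swap sym)
  then show "T u *v w = T w *v u" by (metis vector_eq_rdot)
qed

subsection \<open>Minimizers of the Rayleigh quotient\<close>

text \<open>Along the residual \<open>z\<close> the Rayleigh quotient changes to first order by a
  positive multiple of \<open>z \<bullet> z\<close>, so minimality forces \<open>z = 0\<close>. The
  subspace \<open>S\<close> lets the argument run both on the whole space and on the complement of
  an eigenvector.\<close>

lemma rayleigh_minimizer_eigenvector:
  fixes A :: "real^'n^'n"
  assumes sym: "\<And>h k. (A *v h) \<bullet> k = h \<bullet> (A *v k)"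
    and S: "subspace S" "w \<in> S" "norm w = 1" "A *v w \<in> S"
    and min: "\<And>z. z \<in> S \<Longrightarrow> norm z = 1 \<Longrightarrow> w \<bullet> (A *v w) \<le> z \<bullet> (A *v z)"
  shows "A *v w = (w \<bullet> (A *v w)) *\<^sub>R w"
proof -
  define \<mu> where "\<mu> = w \<bullet> (A *v w)"
  define z where "z = A *v w - \<mu> *\<^sub>R w"
  have zS: "z \<in> S" unfolding z_def using S by (intro subspace_diff subspace_scale)
  have ge: "\<mu> * (norm y)\<^sup>2 \<le> y \<bullet> (A *v y)" if "y \<in> S" for y
  proof (cases "y = 0")
    case False
    have "\<mu> \<le> (y /\<^sub>R norm y) \<bullet> (A *v (y /\<^sub>R norm y))"
      unfolding \<mu>_def using that False S(1) by (intro min subspace_scale) auto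
    also have "\<dots> = (y \<bullet> (A *v y)) / (norm y)\<^sup>2"
      by (simp add: matrix_vector_mult_scaleR power2_eq_square divide_inverse mult_ac)
    finally show ?thesis using False by (simp add: pos_le_divide_eq)
  qed simp
  have ww: "w \<bullet> w = 1" using S(3) by (simp add: norm_eq_1)
  have zw: "z \<bullet> w = 0" unfolding z_def inner_diff_left inner_scaleR_left ww \<mu>_def by (simp add: inner_commute)
  have zz: "z \<bullet> z = z \<bullet> (A *v w)"
  proof -
    have "z \<bullet> z = z \<bullet> (A *v w) - \<mu> * (z \<bullet> w)" by (subst (2) z_def) (simp add: inner_diff_right)
    then show ?thesis using zw by simp
  qed
  define c where "c = z \<bullet> (A *v z) - \<mu> * (z \<bullet> z)"
  have poly: "0 \<le> 2 * t * (z \<bullet> z) + t\<^sup>2 * c" for t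
  proof -
    have "\<mu> * (norm (w + t *\<^sub>R z))\<^sup>2 \<le> (w + t *\<^sub>R z) \<bullet> (A *v (w + t *\<^sub>R z))"
      using S zS by (intro ge subspace_add subspace_scale)
    moreover have "(norm (w + t *\<^sub>R z))\<^sup>2 = 1 + t\<^sup>2 * (z \<bullet> z)"
      unfolding power2_norm_eq_inner using zw ww
      by (simp add: inner_add_left inner_add_right inner_commute power2_eq_square)
    moreover have "(w + t *\<^sub>R z) \<bullet> (A *v (w + t *\<^sub>R z)) = \<mu> + 2 * t * (z \<bullet> z) + t\<^sup>2 * (z \<bullet> (A *v z))"
      using sym[of w z]
      by (simp add: matrix_vector_right_distrib matrix_vector_mult_scaleR inner_add_left inner_add_right
          \<mu>_def zz power2_eq_square inner_commute algebra_simps)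
    ultimately show ?thesis by (simp add: c_def algebra_simps)
  qed
  have "z \<bullet> z = 0"
  proof (rule ccontr)
    assume "z \<bullet> z \<noteq> 0"
    then have pos: "z \<bullet> z > 0" by simp
    \<comment> \<open>Negative and so small that the linear term of \<open>poly\<close> outweighs
      the quadratic one; the 1 guards against \<open>c = 0\<close>.\<close>
    define t where "t = - (z \<bullet> z) / (\<bar>c\<bar> + 1)"
    have t: "t < 0" using pos by (simp add: t_def divide_neg_pos)
    have "t * (\<bar>c\<bar> + 1) = - (z \<bullet> z)" by (simp add: t_def)
    then have "t * (2 * (z \<bullet> z) + t * c) = t * (z \<bullet> z - t * (\<bar>c\<bar> + 1 - c))" by (simp add: algebra_simps)
    moreover have "t * (\<bar>c\<bar> + 1 - c) \<le> 0"
      using t by (intro mult_nonpos_nonneg) auto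
    then have "z \<bullet> z - t * (\<bar>c\<bar> + 1 - c) > 0" using pos by linarith
    ultimately have "t * (2 * (z \<bullet> z) + t * c) < 0" using t by (simp add: mult_neg_pos)
    then show False using poly[of t] by (simp add: power2_eq_square algebra_simps)
  qed
  then show ?thesis by (simp add: z_def \<mu>_def)
qed

text \<open>The minimum is at most \<open>l < 0\<close>, and \<open>l\<close> is the only eigenvalue
  that is not positive, so the two agree. Minimizing again over the complement of \<open>e\<close>
  gives another eigenvector, whose eigenvalue cannot be \<open>l\<close> because that eigenspace is
  a line.\<close>

lemma minimal_eigenvalue_structure:
  fixes A :: "real^'n^'n"
  assumes sym: "\<And>h k. (A *v h) \<bullet> k = h \<bullet> (A *v k)"
    and min: "is_arg_min (\<lambda>u. u \<bullet> (A *v u)) (\<lambda>u. norm u = 1) e"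
    and l: "l < 0" "eigenvalue A l" "dim (eigenspace A l) = 1"
      "\<And>m. eigenvalue A m \<Longrightarrow> m \<noteq> l \<Longrightarrow> m > 0"
  shows "A *v e = l *\<^sub>R e"
    and "\<exists>m>0. \<forall>w. w \<bullet> e = 0 \<longrightarrow> m * (norm w)\<^sup>2 \<le> w \<bullet> (A *v w)"
proof -
  have e: "norm e = 1" and emin: "\<And>z. norm z = 1 \<Longrightarrow> e \<bullet> (A *v e) \<le> z \<bullet> (A *v z)"
    using min by (auto simp: is_arg_min_linorder)
  have ee: "e \<bullet> e = 1" using e by (simp add: norm_eq_1)
  have ev: "A *v e = (e \<bullet> (A *v e)) *\<^sub>R e"
    using e emin by (intro rayleigh_minimizer_eigenvector[OF sym, of UNIV]) auto
  have "e \<bullet> (A *v e) < 0"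
  proof -
    obtain u where u: "A *v u = l *\<^sub>R u" "u \<noteq> 0" using l(2) by (auto simp: eigenvalue_def eigenspace_def)
    have "e \<bullet> (A *v e) \<le> (u /\<^sub>R norm u) \<bullet> (A *v (u /\<^sub>R norm u))" using u by (intro emin) simp
    also have "\<dots> = l * (inverse (norm u) * inverse (norm u) * (u \<bullet> u))"
      by (simp add: matrix_vector_mult_scaleR u(1) mult_ac)
    also have "\<dots> = l" using u(2) by (simp add: dot_square_norm power2_eq_square field_simps)
    finally show ?thesis using l(1) by simp
  qed
  moreover have "eigenvalue A (e \<bullet> (A *v e))"
    unfolding eigenvalue_def eigenspace_def using ev ee by (intro bexI[of _ e]) auto
  ultimately have el: "e \<bullet> (A *v e) = l" using l(4) by fastforce
  with ev show evl: "A *v e = l *\<^sub>R e" by simp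
  define S where "S = {w. w \<bullet> e = 0}"
  have S: "subspace S" unfolding S_def by (auto simp: subspace_def inner_add_left)
  have AS: "A *v w \<in> S" if "w \<in> S" for w
    using that by (simp add: S_def sym evl)
  show "\<exists>m>0. \<forall>w. w \<bullet> e = 0 \<longrightarrow> m * (norm w)\<^sup>2 \<le> w \<bullet> (A *v w)"
  proof (cases "S \<subseteq> {0}")
    \<comment> \<open>In dimension one the complement is trivial and has no unit sphere to minimize
      over.\<close>
    case True
    then show ?thesis by (intro exI[of _ 1]) (auto simp: S_def)
  next
    case False
    have "compact (S \<inter> sphere 0 1)"
      using S by (intro closed_Int_compact closed_subspace) auto
    moreover have "S \<inter> sphere 0 1 \<noteq> {}"
    proof -
      obtain y where "y \<in> S" "y \<noteq> 0" using False by auto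
      then have "y /\<^sub>R norm y \<in> S \<inter> sphere 0 1" using S by (auto intro: subspace_scale)
      then show ?thesis by blast
    qed
    moreover have "continuous_on (S \<inter> sphere 0 1) (\<lambda>u. u \<bullet> (A *v u))"
      by (intro continuous_intros linear_continuous_on matrix_vector_mul_bounded_linear)
    ultimately obtain w where wS: "w \<in> S \<inter> sphere 0 1"
        and wmin: "\<forall>z \<in> S \<inter> sphere 0 1. w \<bullet> (A *v w) \<le> z \<bullet> (A *v z)"
      using continuous_attains_inf by blast
    have w: "w \<in> S" "norm w = 1" "\<And>z. z \<in> S \<Longrightarrow> norm z = 1 \<Longrightarrow> w \<bullet> (A *v w) \<le> z \<bullet> (A *v z)"
      using wS wmin by auto
    define m where "m = w \<bullet> (A *v w)"
    have wm: "A *v w = m *\<^sub>R w"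
      unfolding m_def using w AS by (intro rayleigh_minimizer_eigenvector[OF sym S]) auto
    have w0: "w \<noteq> 0" using w(2) by auto
    have "m \<noteq> l"
    proof
      assume "m = l"
      then have "{e, w} \<subseteq> eigenspace A l" using evl wm by (auto simp: eigenspace_def)
      moreover have "independent {e, w}" and "e \<noteq> w"
      proof -
        show "e \<noteq> w" using w(1) ee by (auto simp: S_def)
        have "pairwise orthogonal {e, w}"
          using w(1) by (auto simp: pairwise_def S_def orthogonal_def inner_commute)
        then show "independent {e, w}"
          using w0 e by (intro pairwise_orthogonal_independent) auto
      qed
      ultimately have "2 \<le> dim (eigenspace A l)"
        using independent_card_le_dim[of "{e, w}" "eigenspace A l"] by simp
      then show False using l(3) by simp
    qed
    moreover have "eigenvalue A m" using wm w0 by (auto simp: eigenvalue_def eigenspace_def)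
    ultimately have "m > 0" using l(4) by blast
    moreover have "m * (norm y)\<^sup>2 \<le> y \<bullet> (A *v y)" if "y \<bullet> e = 0" for y
    proof (cases "y = 0")
      case False
      have "m \<le> (y /\<^sub>R norm y) \<bullet> (A *v (y /\<^sub>R norm y))"
        unfolding m_def using that False S by (intro w(3) subspace_scale) (auto simp: S_def)
      also have "\<dots> = (y \<bullet> (A *v y)) / (norm y)\<^sup>2"
        by (simp add: matrix_vector_mult_scaleR power2_eq_square divide_inverse mult_ac)
      finally show ?thesis using False by (simp add: pos_le_divide_eq)
    qed simp
    ultimately show ?thesis by blast
  qed
qed

subsection \<open>The gradient of the auxiliary function near the saddle point\<close>

lemma has_derivative_tendsto_sequentially:
  fixes f :: "'a::real_normed_vector \<Rightarrow> 'b::real_normed_vector"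
  assumes f': "(f has_derivative f') (at p)"
    and t: "t \<longlonglongrightarrow> 0" "\<And>n::nat. t n > (0::real)" and u: "u \<longlonglongrightarrow> u0"
  shows "(\<lambda>n. (f (p + t n *\<^sub>R u n) - f p) /\<^sub>R t n) \<longlonglongrightarrow> f' u0"
proof -
  interpret f': bounded_linear f' using f' by (rule has_derivative_bounded_linear)
  have b: "(\<lambda>n. t n *\<^sub>R u n) \<longlonglongrightarrow> 0" using tendsto_scaleR[OF t(1) u] by simp
  have "(\<lambda>n. (f (p + t n *\<^sub>R u n) - f p) /\<^sub>R t n - f' (u n)) \<longlonglongrightarrow> 0" (is "?X \<longlonglongrightarrow> 0")
  proof (rule metric_LIMSEQ_I)
    fix e :: real assume "e > 0"
    define N where "N = norm u0 + 1"
    have N: "N > 0" by (simp add: add_nonneg_pos N_def)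
    obtain \<delta> where \<delta>: "\<delta> > 0" "\<And>y. norm (y - p) < \<delta> \<Longrightarrow> norm (f y - f p - f' (y - p)) \<le> e / N * norm (y - p)"
      using f' \<open>e > 0\<close> N unfolding has_derivative_at_alt by (metis divide_pos_pos)
    have "\<forall>\<^sub>F n in sequentially. norm (t n *\<^sub>R u n) < \<delta> \<and> norm (u n) < N"
      using tendstoD[OF b \<delta>(1)] order_tendstoD(2)[OF tendsto_norm[OF u] less_add_one]
      by eventually_elim (auto simp: N_def)
    then have "\<forall>\<^sub>F n in sequentially. dist (?X n) 0 < e"
    proof eventually_elim
      case (elim n)
      have "?X n = (f (p + t n *\<^sub>R u n) - f p - f' (t n *\<^sub>R u n)) /\<^sub>R t n"
        unfolding f'.scaleR scaleR_right_diff_distrib using t(2)[of n] by simp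
      also have "norm \<dots> \<le> (e / N * norm (t n *\<^sub>R u n)) / t n"
        using elim t(2)[of n] \<delta>(2)[of "p + t n *\<^sub>R u n"] by (intro norm_scaleR_inverse_le) auto
      also have "\<dots> = e / N * norm (u n)" using t(2)[of n] by simp
      also have "\<dots> < e / N * N" using elim \<open>e > 0\<close> N by (intro mult_strict_left_mono) auto
      also have "\<dots> = e" using N by simp
      finally show ?case by simp
    qed
    then show "\<exists>no. \<forall>n\<ge>no. dist (?X n) 0 < e"
      by (simp add: eventually_sequentially)
  qed
  moreover have "(\<lambda>n. f' (u n)) \<longlonglongrightarrow> f' u0" by (intro f'.tendsto u)
  ultimately show ?thesis using tendsto_add by fastforce
qed

lemma unit_direction_subsequence:
  fixes h :: "nat \<Rightarrow> 'a::euclidean_space"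
  assumes "\<And>n. h n \<noteq> 0"
  obtains r u where "strict_mono (r :: nat \<Rightarrow> nat)" "norm u = 1"
    "(\<lambda>n. h (r n) /\<^sub>R norm (h (r n))) \<longlonglongrightarrow> u"
proof -
  have "h n /\<^sub>R norm (h n) \<in> sphere 0 1" for n using assms by simp
  moreover have "seq_compact (sphere (0::'a) 1)" by (simp add: compact_imp_seq_compact)
  ultimately obtain u r where "u \<in> sphere 0 1" "strict_mono r" "((\<lambda>n. h n /\<^sub>R norm (h n)) \<circ> r) \<longlonglongrightarrow> u"
    using seq_compactE[of "sphere 0 1" "\<lambda>n. h n /\<^sub>R norm (h n)"] by blast
  then show ?thesis using that by (simp add: o_def)
qed

text \<open>For a unit vector \<open>e\<close> this is e e^T z. It is even in \<open>e\<close> and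
  jointly continuous in both arguments, so limits can be taken along \<open>v (x n)\<close>.\<close>

definition line_proj :: "'a::real_inner \<Rightarrow> 'a \<Rightarrow> 'a" where
  "line_proj e z = (e \<bullet> z) *\<^sub>R e"

lemma tendsto_line_proj [tendsto_intros]:
  "(e \<longlongrightarrow> e0) A \<Longrightarrow> (z \<longlongrightarrow> z0) A \<Longrightarrow> ((\<lambda>n. line_proj (e n) (z n)) \<longlongrightarrow> line_proj e0 z0) A"
  unfolding line_proj_def by (intro tendsto_intros)

lemma line_proj_add: "line_proj e (y + z) = line_proj e y + line_proj e z"
  and line_proj_diff: "line_proj e (y - z) = line_proj e y - line_proj e z"
  and line_proj_scaleR: "line_proj e (t *\<^sub>R z) = t *\<^sub>R line_proj e z"
  by (simp_all add: line_proj_def inner_add_right inner_diff_right algebra_simps)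

text \<open>Here \<open>g\<close>, \<open>H\<close> and \<open>T\<close> stand for the gradient of \<open>V\<close>, its Hessian, and the derivative of the
  Hessian at the saddle point \<open>p\<close>; \<open>F x\<close> below is then the gradient of \<open>y \<mapsto> L(y; x, \<alpha>, \<beta>)\<close>.\<close>

locale saddle_data =
  fixes g :: "real^'n \<Rightarrow> real^'n" and H T :: "real^'n \<Rightarrow> real^'n^'n"
    and p :: "real^'n" and v :: "real^'n \<Rightarrow> real^'n" and \<alpha> \<beta> m :: real and \<mu> :: "real^'n \<Rightarrow> real"
  assumes g': "\<And>x. (g has_derivative (\<lambda>h. H x *v h)) (at x)"
    and H': "(H has_derivative T) (at p)"
    and T_swap: "\<And>u w. T u *v w = T w *v u"
    and T_sym: "\<And>u h w. (T u *v h) \<bullet> w = h \<bullet> (T u *v w)"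
    and H_sym: "\<And>x h w. (H x *v h) \<bullet> w = h \<bullet> (H x *v w)"
    and critical: "g p = 0"
    and norm_v: "\<And>x. norm (v x) = 1"
    and eigen: "\<And>x. H x *v v x = \<mu> x *\<^sub>R v x"
    and negative: "\<mu> p < 0"
    and m_pos: "m > 0"
    and coercive: "\<And>w. w \<bullet> v p = 0 \<Longrightarrow> m * (norm w)\<^sup>2 \<le> w \<bullet> (H p *v w)"
    and v_cont: "isCont v p"
    and sum_gt_1: "\<alpha> + \<beta> > 1"
begin

definition F :: "real^'n \<Rightarrow> real^'n \<Rightarrow> real^'n" where
  "F x y = (1 - \<alpha>) *\<^sub>R g y
     + \<alpha> *\<^sub>R (g (y - line_proj (v x) (y - x)) - line_proj (v x) (g (y - line_proj (v x) (y - x))))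
     - \<beta> *\<^sub>R line_proj (v x) (g (x + line_proj (v x) (y - x)))"

lemma vv [simp]: "v x \<bullet> v x = 1"
  using norm_v by (simp add: norm_eq_1)

lemma T_linear: "linear T"
  using H' by (rule has_derivative_linear)

lemma H_cont: "isCont H p"
  using H' by (rule has_derivative_continuous)

text \<open>Coefficient of t^2 in g(p + t w) - t H(p + t u) w: the first-order term is subtracted
  with the Hessian at p + t u instead of p.\<close>

definition quad_err :: "real^'n \<Rightarrow> real^'n \<Rightarrow> real^'n" where
  "quad_err u w = (1/2) *\<^sub>R (T w *v w) - T u *v w"

text \<open>For x = p + t u the two projected points are displaced from \<open>p\<close> by t times
  the part of \<open>u\<close> along \<open>v x\<close> and t times the rest; the second arguments
  of \<open>quad_err\<close> are the limits of these parts.\<close>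

definition Q :: "real^'n \<Rightarrow> real^'n" where
  "Q u = \<alpha> *\<^sub>R (quad_err u (line_proj (v p) u) - line_proj (v p) (quad_err u (line_proj (v p) u)))
       - \<beta> *\<^sub>R line_proj (v p) (quad_err u (u - line_proj (v p) u))"

lemma tendsto_v:
  assumes "x \<longlonglongrightarrow> p" shows "(\<lambda>n. v (x n)) \<longlonglongrightarrow> v p"
  using v_cont assms by (rule isCont_tendsto_compose)

text \<open>Since \<open>v x\<close> spans an invariant line of \<open>H x\<close>, replacing \<open>H p\<close> by \<open>H x\<close> kills
  the first-order terms of \<open>F x p\<close>; only continuity of \<open>v\<close> is then needed in the limit.\<close>

lemma residual_limit:
  assumes t: "t \<longlonglongrightarrow> 0" "\<And>n::nat. t n > (0::real)" and u: "u \<longlonglongrightarrow> u0"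
  shows "(\<lambda>n. F (p + t n *\<^sub>R u n) p /\<^sub>R (t n)\<^sup>2) \<longlonglongrightarrow> Q u0"
proof -
  define x where "x = (\<lambda>n. p + t n *\<^sub>R u n)"
  have "x \<longlonglongrightarrow> p"
    unfolding x_def using tendsto_add[OF tendsto_const tendsto_scaleR[OF t(1) u]] by simp
  then have e: "(\<lambda>n. v (x n)) \<longlonglongrightarrow> v p" by (rule tendsto_v)
  define E where "E = (\<lambda>w n. (g (p + t n *\<^sub>R w n) - g p - H p *v (t n *\<^sub>R w n)) /\<^sub>R (t n)\<^sup>2
      - ((H (p + t n *\<^sub>R u n) - H p) /\<^sub>R t n) *v w n)"
  have E_lim: "E w \<longlonglongrightarrow> quad_err u0 w0" if "w \<longlonglongrightarrow> w0" for w w0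
    unfolding E_def quad_err_def
    by (intro tendsto_intros tendsto_second_order_taylor[OF g' H' T_swap t that]
        has_derivative_tendsto_sequentially[OF H' t u] that)
  have E_eq: "g (p + t n *\<^sub>R w n) /\<^sub>R (t n)\<^sup>2 = E w n + (H (x n) *v w n) /\<^sub>R t n" for w n
    using t(2)[of n]
    by (simp add: E_def x_def critical matrix_vector_mult_scaleR matrix_vector_mult_diff_rdistrib
        scaleR_right_diff_distrib power2_eq_square flip: scaleR_matrix_vector_assoc)
  define w where "w = (\<lambda>n. line_proj (v (x n)) (u n))"
  define w' where "w' = (\<lambda>n. u n - line_proj (v (x n)) (u n))"
  have w: "w \<longlonglongrightarrow> line_proj (v p) u0" and w': "w' \<longlonglongrightarrow> u0 - line_proj (v p) u0"
    unfolding w_def w'_def by (intro tendsto_intros e u)+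
  \<comment> \<open>These are the terms of order 1/t in \<open>E_eq\<close>: the first is fixed by
    the projection, hence killed by its complement, and the second is killed by the
    projection.\<close>
  have inv: "line_proj (v (x n)) (H (x n) *v w n) = H (x n) *v w n" for n
    by (simp add: w_def line_proj_def matrix_vector_mult_scaleR eigen)
  have inv': "line_proj (v (x n)) (H (x n) *v w' n) = 0" for n
    by (simp add: w'_def line_proj_def eigen inner_diff_right flip: H_sym)
  have "F (p + t n *\<^sub>R u n) p /\<^sub>R (t n)\<^sup>2 =
      \<alpha> *\<^sub>R (E w n - line_proj (v (x n)) (E w n)) - \<beta> *\<^sub>R line_proj (v (x n)) (E w' n)" for n
  proof -
    have px: "p - x n = - t n *\<^sub>R u n" by (simp add: x_def)
    have a: "p - line_proj (v (x n)) (p - x n) = p + t n *\<^sub>R w n"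
      unfolding px line_proj_scaleR w_def by simp
    have b: "x n + line_proj (v (x n)) (p - x n) = p + t n *\<^sub>R w' n"
      unfolding px line_proj_scaleR w'_def by (simp add: x_def scaleR_right_diff_distrib)
    have "F (x n) p /\<^sub>R (t n)\<^sup>2 =
        \<alpha> *\<^sub>R (g (p + t n *\<^sub>R w n) /\<^sub>R (t n)\<^sup>2 - line_proj (v (x n)) (g (p + t n *\<^sub>R w n) /\<^sub>R (t n)\<^sup>2))
        - \<beta> *\<^sub>R line_proj (v (x n)) (g (p + t n *\<^sub>R w' n) /\<^sub>R (t n)\<^sup>2)"
      unfolding F_def a b
      by (simp add: critical line_proj_scaleR scaleR_right_diff_distrib mult.commute)
    then show ?thesis
      unfolding E_eq line_proj_add line_proj_scaleR inv inv' by (simp add: x_def)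
  qed
  moreover have "(\<lambda>n. \<alpha> *\<^sub>R (E w n - line_proj (v (x n)) (E w n)) - \<beta> *\<^sub>R line_proj (v (x n)) (E w' n)) \<longlonglongrightarrow> Q u0"
    unfolding Q_def by (intro tendsto_intros E_lim e w w')
  ultimately show ?thesis by simp
qed

text \<open>The derivative of \<open>F p\<close> at \<open>p\<close>, namely (1 - \<alpha>) H +
  \<alpha> (1 - P) H (1 - P) - \<beta> P H P with H the Hessian at \<open>p\<close> and P the
  projection to the line of \<open>v p\<close>.\<close>

definition A :: "real^'n \<Rightarrow> real^'n" where
  "A h = (1 - \<alpha>) *\<^sub>R (H p *v h)
     + \<alpha> *\<^sub>R (H p *v (h - line_proj (v p) h) - line_proj (v p) (H p *v (h - line_proj (v p) h)))
     - \<beta> *\<^sub>R line_proj (v p) (H p *v line_proj (v p) h)"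

text \<open>The parameter \<open>x n\<close> and the increment tend to their limits together; this
  joint limit is what makes the later bounds uniform in the parameter.\<close>

lemma F_difference_quotient:
  assumes x: "x \<longlonglongrightarrow> p" and t: "t \<longlonglongrightarrow> 0" "\<And>n::nat. t n > (0::real)" and h: "h \<longlonglongrightarrow> h0"
  shows "(\<lambda>n. (F (x n) (p + t n *\<^sub>R h n) - F (x n) p) /\<^sub>R t n) \<longlonglongrightarrow> A h0"
proof -
  note e = tendsto_v[OF x]
  define a where "a = (\<lambda>n. p - line_proj (v (x n)) (p - x n))"
  define b where "b = (\<lambda>n. x n + line_proj (v (x n)) (p - x n))"
  have "a \<longlonglongrightarrow> p - line_proj (v p) (p - p)" "b \<longlonglongrightarrow> p + line_proj (v p) (p - p)"
    unfolding a_def b_def by (intro tendsto_intros e x)+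
  then have a: "a \<longlonglongrightarrow> p" and b: "b \<longlonglongrightarrow> p" by (simp_all add: line_proj_def)
  define w where "w = (\<lambda>n. h n - line_proj (v (x n)) (h n))"
  define w' where "w' = (\<lambda>n. line_proj (v (x n)) (h n))"
  have w: "w \<longlonglongrightarrow> h0 - line_proj (v p) h0" and w': "w' \<longlonglongrightarrow> line_proj (v p) h0"
    unfolding w_def w'_def by (intro tendsto_intros e h)+
  define D where "D = (\<lambda>c w n. (g (c n + t n *\<^sub>R w n) - g (c n)) /\<^sub>R t n)"
  have D: "D c w \<longlonglongrightarrow> H p *v w0" if "c \<longlonglongrightarrow> p" "w \<longlonglongrightarrow> w0" for c w w0
    unfolding D_def by (rule tendsto_strict_difference_quotient[OF g' H_cont that(1) t that(2)])
  have "(F (x n) (p + t n *\<^sub>R h n) - F (x n) p) /\<^sub>R t n =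
     (1 - \<alpha>) *\<^sub>R D (\<lambda>_. p) h n + \<alpha> *\<^sub>R (D a w n - line_proj (v (x n)) (D a w n))
       - \<beta> *\<^sub>R line_proj (v (x n)) (D b w' n)" for n
  proof -
    have 1: "(p + t n *\<^sub>R h n) - line_proj (v (x n)) ((p + t n *\<^sub>R h n) - x n) = a n + t n *\<^sub>R w n"
      by (simp add: a_def w_def line_proj_add line_proj_diff line_proj_scaleR algebra_simps)
    have 2: "x n + line_proj (v (x n)) ((p + t n *\<^sub>R h n) - x n) = b n + t n *\<^sub>R w' n"
      by (simp add: b_def w'_def line_proj_add line_proj_diff line_proj_scaleR algebra_simps)
    have 3: "p - line_proj (v (x n)) (p - x n) = a n" "x n + line_proj (v (x n)) (p - x n) = b n"
      by (simp_all add: a_def b_def)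
    have alg: "(((1 - \<alpha>) *\<^sub>R X + \<alpha> *\<^sub>R (Y - line_proj e Y) - \<beta> *\<^sub>R line_proj e Z)
         - ((1 - \<alpha>) *\<^sub>R X' + \<alpha> *\<^sub>R (Y' - line_proj e Y') - \<beta> *\<^sub>R line_proj e Z')) /\<^sub>R s =
       (1 - \<alpha>) *\<^sub>R ((X - X') /\<^sub>R s) + \<alpha> *\<^sub>R ((Y - Y') /\<^sub>R s - line_proj e ((Y - Y') /\<^sub>R s))
         - \<beta> *\<^sub>R line_proj e ((Z - Z') /\<^sub>R s)" for X Y Z X' Y' Z' e :: "real^'n" and s
      unfolding line_proj_scaleR line_proj_diff by (simp add: algebra_simps)
    show ?thesis
      unfolding F_def 1 2 3 D_def by (rule alg)
  qed
  moreover have "(\<lambda>n. (1 - \<alpha>) *\<^sub>R D (\<lambda>_. p) h n + \<alpha> *\<^sub>R (D a w n - line_proj (v (x n)) (D a w n))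
       - \<beta> *\<^sub>R line_proj (v (x n)) (D b w' n)) \<longlonglongrightarrow> A h0"
    unfolding A_def by (intro tendsto_intros D a b w w' e h)
  ultimately show ?thesis by simp
qed

lemma A_positive_definite:
  assumes "h \<noteq> 0"
  shows "A h \<bullet> h > 0"
proof -
  define e where "e = v p"
  define c where "c = e \<bullet> h"
  define w where "w = h - c *\<^sub>R e"
  have ee: "e \<bullet> e = 1" by (simp add: e_def)
  have ew: "e \<bullet> w = 0" by (simp add: w_def inner_diff_right ee c_def)
  have he: "h = c *\<^sub>R e + w" by (simp add: w_def)
  have He: "H p *v e = \<mu> p *\<^sub>R e" by (simp add: e_def eigen)
  have eHw: "e \<bullet> (H p *v w) = 0" by (simp add: He ew flip: H_sym)
  have pe: "line_proj (v p) h = c *\<^sub>R e" by (simp add: line_proj_def e_def c_def)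
  have "A h = ((1 - \<alpha> - \<beta>) * \<mu> p * c) *\<^sub>R e + H p *v w"
  proof -
    have Hh: "H p *v h = (c * \<mu> p) *\<^sub>R e + H p *v w"
      by (simp add: he matrix_vector_right_distrib matrix_vector_mult_scaleR He)
    have hw: "h - c *\<^sub>R e = w" by (simp add: w_def)
    show ?thesis
      unfolding A_def pe hw Hh
      by (simp add: line_proj_def matrix_vector_mult_scaleR He eHw ee algebra_simps flip: e_def)
  qed
  then have eq: "A h \<bullet> h = (1 - \<alpha> - \<beta>) * \<mu> p * c\<^sup>2 + w \<bullet> (H p *v w)"
    using ee ew eHw
    by (simp add: he inner_add_left inner_add_right inner_commute power2_eq_square)
  have wH: "m * (norm w)\<^sup>2 \<le> w \<bullet> (H p *v w)"
    using ew by (intro coercive) (simp add: e_def inner_commute)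
  \<comment> \<open>Both factors are negative: \<alpha> + \<beta> > 1 turns the unstable direction
    into a stable one.\<close>
  have k: "(1 - \<alpha> - \<beta>) * \<mu> p > 0" using sum_gt_1 negative by (intro mult_neg_neg) auto
  show ?thesis
  proof (cases "c = 0")
    case True
    then have "w \<noteq> 0" using assms he by auto
    then have "m * (norm w)\<^sup>2 > 0" using m_pos by simp
    then show ?thesis using wH eq True by simp
  next
    case False
    then have "(1 - \<alpha> - \<beta>) * \<mu> p * c\<^sup>2 > 0" using k by simp
    moreover have "m * (norm w)\<^sup>2 \<ge> 0" using m_pos by simp
    ultimately show ?thesis using wH eq by linarith
  qed
qed

end

section \<open>Uniform estimates by compactness of the unit sphere, and the vanishing of Q\<close>

context saddle_data begin

lemma F_quotient_subsequence:
  assumes x: "x \<longlonglongrightarrow> p" and h: "h \<longlonglongrightarrow> 0" "\<And>n::nat. h n \<noteq> 0"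
  obtains s u where "strict_mono (s :: nat \<Rightarrow> nat)" "norm u = 1"
    "(\<lambda>n. h (s n) /\<^sub>R norm (h (s n))) \<longlonglongrightarrow> u"
    "(\<lambda>n. (F (x (s n)) (p + h (s n)) - F (x (s n)) p) /\<^sub>R norm (h (s n))) \<longlonglongrightarrow> A u"
proof -
  obtain s u where s: "strict_mono s" "norm u = 1" and u: "(\<lambda>n. h (s n) /\<^sub>R norm (h (s n))) \<longlonglongrightarrow> u"
    using unit_direction_subsequence[of h, OF h(2)] by blast
  have "(\<lambda>n. norm (h (s n))) \<longlonglongrightarrow> 0"
    using LIMSEQ_subseq_LIMSEQ[OF tendsto_norm_zero[OF h(1)] s(1)] by (simp add: o_def)
  moreover have "(\<lambda>n. x (s n)) \<longlonglongrightarrow> p"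
    using LIMSEQ_subseq_LIMSEQ[OF x s(1)] by (simp add: o_def)
  ultimately have "(\<lambda>n. (F (x (s n)) (p + norm (h (s n)) *\<^sub>R (h (s n) /\<^sub>R norm (h (s n)))) - F (x (s n)) p)
      /\<^sub>R norm (h (s n))) \<longlonglongrightarrow> A u"
    using h(2) by (intro F_difference_quotient u) auto
  moreover have "norm (h (s n)) *\<^sub>R (h (s n) /\<^sub>R norm (h (s n))) = h (s n)" for n
    using h(2)[of "s n"] by simp
  ultimately show ?thesis using that[OF s u] by simp
qed

lemma residual_subsequence:
  assumes x: "x \<longlonglongrightarrow> p" "\<And>n::nat. x n \<noteq> p"
  obtains s u where "strict_mono (s :: nat \<Rightarrow> nat)" "norm u = 1"
    "(\<lambda>n. norm (F (x (s n)) p) / (dist (x (s n)) p)\<^sup>2) \<longlonglongrightarrow> norm (Q u)"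
proof -
  define h where "h = (\<lambda>n. x n - p)"
  have h: "h \<longlonglongrightarrow> 0" "\<And>n. h n \<noteq> 0" using x by (auto simp: h_def LIM_zero_iff)
  obtain s u where s: "strict_mono s" "norm u = 1" and u: "(\<lambda>n. h (s n) /\<^sub>R norm (h (s n))) \<longlonglongrightarrow> u"
    using unit_direction_subsequence[of h, OF h(2)] by blast
  have "(\<lambda>n. norm (h (s n))) \<longlonglongrightarrow> 0"
    using LIMSEQ_subseq_LIMSEQ[OF tendsto_norm_zero[OF h(1)] s(1)] by (simp add: o_def)
  then have "(\<lambda>n. norm (F (p + norm (h (s n)) *\<^sub>R (h (s n) /\<^sub>R norm (h (s n)))) p /\<^sub>R (norm (h (s n)))\<^sup>2))
      \<longlonglongrightarrow> norm (Q u)"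
    using h(2) by (intro tendsto_norm residual_limit u) auto
  moreover have "p + norm (h (s n)) *\<^sub>R (h (s n) /\<^sub>R norm (h (s n))) = x (s n)" for n
    using h(2)[of "s n"] by (simp add: h_def)
  moreover have "norm (F (x (s n)) p /\<^sub>R (norm (h (s n)))\<^sup>2) = norm (F (x (s n)) p) / (dist (x (s n)) p)\<^sup>2" for n
    by (simp add: h_def dist_norm divide_inverse_commute)
  ultimately show ?thesis using that[OF s] by simp
qed

text \<open>If the bound failed for c = r = 1/(n + 1) and every n, the normalized violating
  increments would have a limit \<open>u\<close> on the unit sphere with
  \<open>A u \<bullet> u \<le> 0\<close>. Comparison with \<open>p\<close> alone suffices, as only
  the distance from \<open>p\<close> to a zero of \<open>F x\<close> is to be estimated.\<close>

lemma F_strongly_monotone: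
  obtains c r where "c > 0" "r > 0"
    "\<And>x h. norm (x - p) < r \<Longrightarrow> norm h < r \<Longrightarrow> c * (norm h)\<^sup>2 \<le> (F x (p + h) - F x p) \<bullet> h"
proof (rule ccontr)
  assume "\<not> thesis"
  then have "\<exists>x h. norm (x - p) < 1 / Suc n \<and> norm h < 1 / Suc n
      \<and> (F x (p + h) - F x p) \<bullet> h < (1 / Suc n) * (norm h)\<^sup>2" for n :: nat
    using that[of "1 / Suc n" "1 / Suc n"] by (meson not_less of_nat_0_less_iff zero_less_Suc zero_less_divide_1_iff)
  then obtain x h where xh: "\<And>n. norm (x n - p) < 1 / Suc n" "\<And>n. norm (h n) < 1 / Suc n"
      "\<And>n. (F (x n) (p + h n) - F (x n) p) \<bullet> h n < (1 / Suc n) * (norm (h n))\<^sup>2"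
    by metis
  have inv0: "(\<lambda>n. 1 / real (Suc n)) \<longlonglongrightarrow> 0" by (rule LIMSEQ_Suc[OF lim_1_over_n])
  have h0: "h n \<noteq> 0" for n using xh(3)[of n] by auto
  have x_lim: "x \<longlonglongrightarrow> p"
    by (rule LIM_zero_cancel, rule LIMSEQ_norm_0) (rule xh(1))
  have h_lim: "h \<longlonglongrightarrow> 0"
    by (rule LIMSEQ_norm_0) (rule xh(2))
  obtain s u where s: "strict_mono s" "norm u = 1" and u: "(\<lambda>n. h (s n) /\<^sub>R norm (h (s n))) \<longlonglongrightarrow> u"
    and lim: "(\<lambda>n. (F (x (s n)) (p + h (s n)) - F (x (s n)) p) /\<^sub>R norm (h (s n))) \<longlonglongrightarrow> A u"
    using F_quotient_subsequence[OF x_lim h_lim h0] by blast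
  have "A u \<bullet> u \<le> 0"
  proof (rule LIMSEQ_le)
    show "(\<lambda>n. ((F (x (s n)) (p + h (s n)) - F (x (s n)) p) /\<^sub>R norm (h (s n))) \<bullet> (h (s n) /\<^sub>R norm (h (s n)))) \<longlonglongrightarrow> A u \<bullet> u"
      by (intro tendsto_intros lim u)
    show "(\<lambda>n. 1 / real (Suc (s n))) \<longlonglongrightarrow> 0"
      using LIMSEQ_subseq_LIMSEQ[OF inv0 s(1)] by (simp add: o_def)
    have "((F (x k) (p + h k) - F (x k) p) /\<^sub>R norm (h k)) \<bullet> (h k /\<^sub>R norm (h k)) \<le> 1 / real (Suc k)" for k
    proof -
      have "((F (x k) (p + h k) - F (x k) p) /\<^sub>R norm (h k)) \<bullet> (h k /\<^sub>R norm (h k))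
          = ((F (x k) (p + h k) - F (x k) p) \<bullet> h k) / (norm (h k))\<^sup>2"
        by (simp add: power2_eq_square divide_inverse)
      also have "\<dots> \<le> 1 / real (Suc k)"
        using xh(3)[of k] h0[of k] by (subst pos_divide_le_eq) (auto intro: less_imp_le)
      finally show ?thesis .
    qed
    then show "\<exists>N. \<forall>n\<ge>N. ((F (x (s n)) (p + h (s n)) - F (x (s n)) p) /\<^sub>R norm (h (s n))) \<bullet> (h (s n) /\<^sub>R norm (h (s n)))
        \<le> 1 / real (Suc (s n))" by blast
  qed
  moreover have "u \<noteq> 0" using s(2) by auto
  ultimately show False using A_positive_definite[of u] by simp
qed

text \<open>Failure with M = n + 1 at radius 1/(n + 1) would make the difference quotients unbounded
  along a subsequence on which they converge.\<close>

lemma F_lipschitz: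
  obtains M r where "M > 0" "r > 0"
    "\<And>x h. norm (x - p) < r \<Longrightarrow> norm h < r \<Longrightarrow> norm (F x (p + h) - F x p) \<le> M * norm h"
proof (rule ccontr)
  assume "\<not> thesis"
  then have "\<exists>x h. norm (x - p) < 1 / Suc n \<and> norm h < 1 / Suc n \<and> Suc n * norm h < norm (F x (p + h) - F x p)" for n
    using that[of "Suc n" "1 / Suc n"] by (meson not_less of_nat_0_less_iff zero_less_Suc zero_less_divide_1_iff)
  then obtain x h where xh: "\<And>n. norm (x n - p) < 1 / Suc n" "\<And>n. norm (h n) < 1 / Suc n"
      "\<And>n. Suc n * norm (h n) < norm (F (x n) (p + h n) - F (x n) p)"
    by metis
  have h0: "h n \<noteq> 0" for n using xh(3)[of n] by auto
  have x_lim: "x \<longlonglongrightarrow> p"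
    by (rule LIM_zero_cancel, rule LIMSEQ_norm_0) (rule xh(1))
  have h_lim: "h \<longlonglongrightarrow> 0"
    by (rule LIMSEQ_norm_0) (rule xh(2))
  obtain s u where s: "strict_mono s"
    and lim: "(\<lambda>n. (F (x (s n)) (p + h (s n)) - F (x (s n)) p) /\<^sub>R norm (h (s n))) \<longlonglongrightarrow> A u"
    using F_quotient_subsequence[OF x_lim h_lim h0] by blast
  obtain K where K: "\<And>n. norm ((F (x (s n)) (p + h (s n)) - F (x (s n)) p) /\<^sub>R norm (h (s n))) \<le> K"
    using convergent_imp_Bseq[OF convergentI[OF lim]] unfolding Bseq_def by blast
  have "real n \<le> K" for n
  proof -
    have "real n \<le> Suc (s n)" using seq_suble[OF s, of n] by simp
    also have "\<dots> \<le> norm (F (x (s n)) (p + h (s n)) - F (x (s n)) p) / norm (h (s n))"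
      using xh(3)[of "s n"] h0[of "s n"] by (subst pos_le_divide_eq) auto
    also have "\<dots> \<le> K" using K[of n] by (simp add: divide_inverse_commute)
    finally show ?thesis .
  qed
  then show False using reals_Archimedean2[of K] by (meson not_less)
qed

lemma F_p_p: "F p p = 0"
  by (simp add: F_def line_proj_def critical)

text \<open>Shared contradiction argument: with \<open>C\<close> above a bound for |Q| it gives the
  O(dist^2) estimate, with an arbitrary \<epsilon> the o(dist^2) estimate.\<close>

lemma residual_sequence:
  assumes "\<And>r. r > 0 \<Longrightarrow> \<exists>x. dist x p < r \<and> C * (dist x p)\<^sup>2 < norm (F x p)" and "C \<ge> 0"
  obtains u where "norm u = 1" "C \<le> norm (Q u)"
proof -
  have "\<exists>x. dist x p < 1 / Suc n \<and> C * (dist x p)\<^sup>2 < norm (F x p)" for n :: nat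
    using assms by simp
  then obtain x where x: "\<And>n. dist (x n) p < 1 / Suc n" "\<And>n. C * (dist (x n) p)\<^sup>2 < norm (F (x n) p)" by metis
  have x0: "x n \<noteq> p" for n
  proof
    assume "x n = p"
    with x(2)[of n] show False by (simp add: F_p_p)
  qed
  have x_lim: "x \<longlonglongrightarrow> p"
    by (rule LIM_zero_cancel, rule LIMSEQ_norm_0) (rule x(1)[unfolded dist_norm])
  obtain s u where s: "strict_mono s" "norm u = 1"
    and lim: "(\<lambda>n. norm (F (x (s n)) p) / (dist (x (s n)) p)\<^sup>2) \<longlonglongrightarrow> norm (Q u)"
    using residual_subsequence[OF x_lim x0] by blast
  have "C \<le> norm (F (x (s n)) p) / (dist (x (s n)) p)\<^sup>2" for n
    using x(2)[of "s n"] x0[of "s n"] by (subst pos_le_divide_eq) auto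
  then have "C \<le> norm (Q u)" using lim by (intro LIMSEQ_le_const[OF lim]) auto
  then show ?thesis using that s(2) by blast
qed

lemma Q_bounded: obtains K where "K \<ge> 0" "\<And>u. norm u = 1 \<Longrightarrow> norm (Q u) \<le> K"
proof -
  have T: "continuous_on X (\<lambda>u. T (f u))" if "continuous_on X f" for X :: "(real^'n) set" and f
    using linear_continuous_on_compose[OF that T_linear] .
  have mv: "continuous_on X (\<lambda>u. B u *v f u)" if "continuous_on X B" "continuous_on X f"
    for X :: "(real^'n) set" and B :: "_ \<Rightarrow> real^'n^'n" and f :: "_ \<Rightarrow> real^'n"
    using bounded_bilinear.continuous_on[OF bounded_bilinear_matrix_vector_mult that] .
  have "continuous_on (sphere 0 1) (\<lambda>u. norm (Q u))"
    unfolding Q_def quad_err_def line_proj_def by (intro continuous_intros T mv)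
  then have "bounded ((\<lambda>u. norm (Q u)) ` sphere 0 1)"
    by (intro compact_imp_bounded compact_continuous_image compact_sphere)
  then obtain K where "\<forall>u\<in>sphere 0 1. norm (Q u) \<le> K"
    unfolding bounded_iff by auto
  then have "norm (Q u) \<le> max K 0" if "norm u = 1" for u using that by (simp add: le_max_iff_disj)
  then show ?thesis using that[of "max K 0"] by simp
qed

lemma residual_quadratic:
  obtains C r where "C > 0" "r > 0" "\<And>x. dist x p < r \<Longrightarrow> norm (F x p) \<le> C * (dist x p)\<^sup>2"
proof -
  obtain K where K: "K \<ge> 0" "\<And>u. norm u = 1 \<Longrightarrow> norm (Q u) \<le> K" using Q_bounded by blast
  have "\<exists>r>0. \<forall>x. dist x p < r \<longrightarrow> norm (F x p) \<le> (K + 1) * (dist x p)\<^sup>2"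
  proof (rule ccontr)
    assume "\<not> ?thesis"
    then have "\<And>r. r > 0 \<Longrightarrow> \<exists>x. dist x p < r \<and> (K + 1) * (dist x p)\<^sup>2 < norm (F x p)"
      by (meson not_less)
    then obtain u where "norm u = 1" "K + 1 \<le> norm (Q u)"
      using residual_sequence[of "K + 1"] K(1) by auto
    then show False using K(2)[of u] by simp
  qed
  then show ?thesis using that[of "K + 1"] K(1) by auto
qed

text \<open>One direction is the compactness argument; in the other, the bound restricted to the ray
  p + t u forces the limit \<open>Q u\<close> to be 0.\<close>

lemma residual_little_o_iff:
  "(\<forall>\<epsilon>>0. \<forall>\<^sub>F x in at p. norm (F x p) \<le> \<epsilon> * (dist x p)\<^sup>2) \<longleftrightarrow> (\<forall>u. Q u = 0)"
proof
  assume Q: "\<forall>u. Q u = 0"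
  show "\<forall>\<epsilon>>0. \<forall>\<^sub>F x in at p. norm (F x p) \<le> \<epsilon> * (dist x p)\<^sup>2"
  proof (intro allI impI)
    fix \<epsilon> :: real assume "\<epsilon> > 0"
    have "\<exists>r>0. \<forall>x. dist x p < r \<longrightarrow> norm (F x p) \<le> \<epsilon> * (dist x p)\<^sup>2"
    proof (rule ccontr)
      assume "\<not> ?thesis"
      then have "\<And>r. r > 0 \<Longrightarrow> \<exists>x. dist x p < r \<and> \<epsilon> * (dist x p)\<^sup>2 < norm (F x p)"
        by (meson not_less)
      then obtain u where "norm u = 1" "\<epsilon> \<le> norm (Q u)"
        using residual_sequence[of \<epsilon>] \<open>\<epsilon> > 0\<close> by auto
      then show False using Q \<open>\<epsilon> > 0\<close> by simp
    qed
    then show "\<forall>\<^sub>F x in at p. norm (F x p) \<le> \<epsilon> * (dist x p)\<^sup>2"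
      unfolding eventually_at by blast
  qed
next
  assume o: "\<forall>\<epsilon>>0. \<forall>\<^sub>F x in at p. norm (F x p) \<le> \<epsilon> * (dist x p)\<^sup>2"
  show "\<forall>u. Q u = 0"
  proof
    fix u
    define t where "t = (\<lambda>n. 1 / real (Suc n))"
    have t: "t \<longlonglongrightarrow> 0" "\<And>n. t n > 0"
      unfolding t_def by (rule LIMSEQ_Suc[OF lim_1_over_n]) simp
    have lim: "(\<lambda>n. norm (F (p + t n *\<^sub>R u) p /\<^sub>R (t n)\<^sup>2)) \<longlonglongrightarrow> norm (Q u)"
      by (intro tendsto_norm residual_limit t tendsto_const)
    have x: "(\<lambda>n. p + t n *\<^sub>R u) \<longlonglongrightarrow> p"
      using tendsto_add[OF tendsto_const tendsto_scaleR[OF t(1) tendsto_const]] by simp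
    have "norm (Q u) \<le> \<epsilon> * (norm u)\<^sup>2" if "\<epsilon> > 0" for \<epsilon>
    proof -
      \<comment> \<open>At \<open>p\<close> itself both sides are 0, so the bound holds on a full
        neighborhood; this covers \<open>u = 0\<close>, where the sequence stays at
        \<open>p\<close>.\<close>
      have ev: "\<forall>\<^sub>F x in nhds p. norm (F x p) \<le> \<epsilon> * (dist x p)\<^sup>2"
        using o \<open>\<epsilon> > 0\<close> unfolding eventually_nhds_conv_at by (simp add: F_p_p)
      have "\<forall>\<^sub>F n in sequentially. norm (F (p + t n *\<^sub>R u) p) \<le> \<epsilon> * (dist (p + t n *\<^sub>R u) p)\<^sup>2"
        using eventually_compose_filterlim[OF ev x] .
      then have "\<forall>\<^sub>F n in sequentially. norm (F (p + t n *\<^sub>R u) p /\<^sub>R (t n)\<^sup>2) \<le> \<epsilon> * (norm u)\<^sup>2"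
      proof eventually_elim
        case (elim n)
        have "norm (F (p + t n *\<^sub>R u) p /\<^sub>R (t n)\<^sup>2) \<le> (\<epsilon> * (dist (p + t n *\<^sub>R u) p)\<^sup>2) / (t n)\<^sup>2"
          using elim t(2)[of n] by (intro norm_scaleR_inverse_le) auto
        also have "\<dots> = \<epsilon> * (norm u)\<^sup>2" using t(2)[of n] by (simp add: dist_norm power_mult_distrib)
        finally show ?case .
      qed
      then show ?thesis using tendsto_upperbound[OF lim] by simp
    qed
    then have le: "norm (Q u) \<le> \<epsilon> * (norm u)\<^sup>2" if "\<epsilon> > 0" for \<epsilon> using that by blast
    have "norm (Q u) \<le> 0"
    proof (rule field_le_epsilon)
      fix e :: real assume "e > 0"
      define D where "D = (norm u)\<^sup>2 + 1"
      have D: "D > 0" "(norm u)\<^sup>2 \<le> D" by (auto simp: D_def add_nonneg_pos)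
      have "norm (Q u) \<le> e / D * (norm u)\<^sup>2" using \<open>e > 0\<close> D by (intro le) simp
      also have "\<dots> \<le> e / D * D" using \<open>e > 0\<close> D by (intro mult_left_mono) auto
      finally show "norm (Q u) \<le> 0 + e" using D by simp
    qed
    then show "Q u = 0" by simp
  qed
qed

lemma Q_eq_0_iff:
  "(\<forall>u. Q u = 0) \<longleftrightarrow> (\<forall>u w. w \<bullet> v p = 0 \<longrightarrow> w \<bullet> (T u *v v p) = 0)"
proof -
  define e where "e = v p"
  have ee [simp]: "e \<bullet> e = 1" by (simp add: e_def)
  have scale: "T (c *\<^sub>R u) *v w = c *\<^sub>R (T u *v w)" and add: "T (u + y) *v w = T u *v w + T y *v w" for c u y w
    unfolding linear_cmul[OF T_linear] linear_add[OF T_linear]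
    by (rule scaleR_matrix_vector_assoc[symmetric], rule matrix_vector_mult_add_rdistrib)
  have qe: "quad_err u (line_proj e u) = ((e \<bullet> u)\<^sup>2 / 2) *\<^sub>R (T e *v e) - (e \<bullet> u) *\<^sub>R (T u *v e)" for u
    by (simp add: quad_err_def line_proj_def scale matrix_vector_mult_scaleR power2_eq_square)
  have Qe: "Q u = \<alpha> *\<^sub>R (quad_err u (line_proj e u) - line_proj e (quad_err u (line_proj e u)))
       - \<beta> *\<^sub>R line_proj e (quad_err u (u - line_proj e u))" for u
    by (simp add: Q_def e_def)
  have perp: "e \<bullet> (z - line_proj e z) = 0" for z
    by (simp add: line_proj_def inner_diff_right)
  have eT: "e \<bullet> quad_err u w = (w \<bullet> (T w *v e)) / 2 - w \<bullet> (T u *v e)" for u w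
  proof -
    have "e \<bullet> (T y *v w) = w \<bullet> (T y *v e)" for y by (metis T_sym inner_commute)
    then show ?thesis by (simp add: quad_err_def inner_diff_right)
  qed
  show ?thesis unfolding e_def[symmetric]
  proof
    assume deg: "\<forall>u w. w \<bullet> e = 0 \<longrightarrow> w \<bullet> (T u *v e) = 0"
    show "\<forall>u. Q u = 0"
    proof
      fix u
      define z where "z = quad_err u (line_proj e u)"
      define d where "d = z - line_proj e z"
      have de: "d \<bullet> e = 0" using perp[of z] by (simp add: d_def inner_commute)
      \<comment> \<open>\<open>z\<close> is a combination of \<open>T e *v e\<close> and
        \<open>T u *v e\<close>, and under \<open>deg\<close> both are orthogonal to every vector
        orthogonal to \<open>e\<close>.\<close>
      have "d \<bullet> z = 0" using deg de by (simp add: z_def qe inner_diff_right)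
      then have "d \<bullet> d = 0" using de by (subst (2) d_def) (simp add: inner_diff_right line_proj_def)
      then have "d = 0" by simp
      have "e \<bullet> quad_err u (u - line_proj e u) = 0"
        using deg perp[of u] by (simp add: eT inner_commute[of _ e])
      then have "line_proj e (quad_err u (u - line_proj e u)) = 0" by (simp add: line_proj_def)
      moreover have "Q u = \<alpha> *\<^sub>R d - \<beta> *\<^sub>R line_proj e (quad_err u (u - line_proj e u))"
        by (simp only: Qe d_def z_def)
      ultimately show "Q u = 0" using \<open>d = 0\<close> by simp
    qed
  next
    assume Q0: "\<forall>u. Q u = 0"
    have "\<alpha> \<noteq> 0 \<or> \<beta> \<noteq> 0" using sum_gt_1 by auto
    then show "\<forall>u w. w \<bullet> e = 0 \<longrightarrow> w \<bullet> (T u *v e) = 0"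
    proof
      assume "\<alpha> \<noteq> 0"
      have wq: "w \<bullet> quad_err u (line_proj e u) = 0" if "w \<bullet> e = 0" for u w
      proof -
        have "0 = w \<bullet> Q u" using Q0 by simp
        also have "\<dots> = \<alpha> * (w \<bullet> quad_err u (line_proj e u))"
          using that by (simp add: Qe inner_diff_right line_proj_def)
        finally show ?thesis using \<open>\<alpha> \<noteq> 0\<close> by simp
      qed
      have c: "(e \<bullet> u)\<^sup>2 / 2 * (w \<bullet> (T e *v e)) = (e \<bullet> u) * (w \<bullet> (T u *v e))" if "w \<bullet> e = 0" for u w
        using wq[OF that, of u] by (simp add: qe inner_diff_right)
      \<comment> \<open>For \<open>u = e\<close> the two sides of \<open>c\<close> carry the
        different coefficients 1/2 and 1.\<close>
      have ce: "w \<bullet> (T e *v e) = 0" if "w \<bullet> e = 0" for w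
        using c[OF that, of e] by simp
      have cu: "w \<bullet> (T u *v e) = 0" if "w \<bullet> e = 0" "e \<bullet> u \<noteq> 0" for u w
        using c[OF that(1), of u] ce[OF that(1)] that(2) by simp
      show ?thesis
      proof (intro allI impI)
        fix u w assume w: "w \<bullet> e = 0"
        show "w \<bullet> (T u *v e) = 0"
        proof (cases "e \<bullet> u = 0")
          \<comment> \<open>Adding \<open>e\<close> to \<open>u\<close> makes its component along
            \<open>e\<close> nonzero.\<close>
          case True
          then have "w \<bullet> (T (u + e) *v e) = 0" by (intro cu w) (simp add: inner_add_right)
          then show ?thesis using ce[OF w] by (simp add: add inner_add_right)
        qed (rule cu[OF w])
      qed
    next
      assume "\<beta> \<noteq> 0"
      \<comment> \<open>Pairing \<open>Q\<close> with \<open>e\<close> isolates its \<beta> part;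
        the values 0 and 1 of \<open>c\<close> then separate the two unknown derivatives.\<close>
      have q: "(w \<bullet> (T w *v e)) / 2 = w \<bullet> (T (c *\<^sub>R e + w) *v e)" if "w \<bullet> e = 0" for c w
      proof -
        have pu: "(c *\<^sub>R e + w) - line_proj e (c *\<^sub>R e + w) = w"
          using that by (simp add: line_proj_def inner_add_right inner_commute)
        have "0 = e \<bullet> Q (c *\<^sub>R e + w)" using Q0 by simp
        also have "\<dots> = - \<beta> * (e \<bullet> quad_err (c *\<^sub>R e + w) w)"
          unfolding Qe pu by (simp add: inner_diff_right line_proj_def)
        finally show ?thesis using \<open>\<beta> \<noteq> 0\<close> by (simp add: eT)
      qed
      have ww: "w \<bullet> (T w *v e) = 0" if "w \<bullet> e = 0" for w
        using q[OF that, of 0] by simp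
      have we: "w \<bullet> (T e *v e) = 0" if "w \<bullet> e = 0" for w
        using q[OF that, of 1] ww[OF that] by (simp add: add inner_add_right)
      \<comment> \<open>On the complement of \<open>e\<close> the form w \<bullet> (T y e) is
        symmetric, by symmetry of the third derivative, and zero on the diagonal.\<close>
      have polar: "w \<bullet> (T y *v e) = 0" if "w \<bullet> e = 0" "y \<bullet> e = 0" for w y
      proof -
        have "(w + y) \<bullet> (T (w + y) *v e) = 0" using that by (intro ww) (simp add: inner_add_left)
        then have "w \<bullet> (T y *v e) + y \<bullet> (T w *v e) = 0"
          using ww that by (simp add: add inner_add_left inner_add_right)
        moreover have "y \<bullet> (T w *v e) = w \<bullet> (T y *v e)"
          by (metis T_swap T_sym inner_commute)
        ultimately show ?thesis by simp
      qed
      show ?thesis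
      proof (intro allI impI)
        fix u w assume w: "w \<bullet> e = 0"
        define y where "y = u - line_proj e u"
        have y: "y \<bullet> e = 0" using perp[of u] by (simp add: y_def inner_commute)
        have u: "u = (e \<bullet> u) *\<^sub>R e + y" by (simp add: y_def line_proj_def)
        have "w \<bullet> (T u *v e) = (e \<bullet> u) * (w \<bullet> (T e *v e)) + w \<bullet> (T y *v e)"
          by (subst u) (simp only: add scale inner_add_right inner_scaleR_right)
        then show "w \<bullet> (T u *v e) = 0" using we[OF w] polar[OF w y] by simp
      qed
    qed
  qed
qed

end

subsection \<open>Minimizers and local quadratic convergence\<close>

text \<open>On the boundary sphere G y \<bullet> (y - p) \<ge> (c r - |G p|) r > 0, so a short step
  towards \<open>p\<close> lowers \<open>f\<close>. The minimum over the closed ball is therefore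
  attained inside, where the gradient vanishes.\<close>

lemma interior_minimizer:
  fixes f :: "'a::euclidean_space \<Rightarrow> real"
  assumes f': "\<And>y. (f has_derivative (\<lambda>h. G y \<bullet> h)) (at y)"
    and "r > 0"
    and mono: "\<And>h. norm h \<le> r \<Longrightarrow> c * (norm h)\<^sup>2 \<le> (G (p + h) - G p) \<bullet> h"
    and small: "norm (G p) < c * r"
  obtains y where "y \<in> ball p r" "G y = 0" "\<And>z. z \<in> cball p r \<Longrightarrow> f y \<le> f z"
proof -
  have "continuous_on (cball p r) f"
    using has_derivative_continuous[OF f'] by (intro continuous_at_imp_continuous_on) simp
  moreover have "cball p r \<noteq> {}" using \<open>r > 0\<close> by simp
  ultimately obtain y where y: "y \<in> cball p r" and ymin: "\<forall>z\<in>cball p r. f y \<le> f z"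
    using continuous_attains_inf[OF compact_cball] by blast
  have "norm (y - p) \<noteq> r"
  proof
    assume ny: "norm (y - p) = r"
    define h where "h = y - p"
    have h: "norm h = r" using ny by (simp add: h_def)
    have "c * r\<^sup>2 \<le> G y \<bullet> h - G p \<bullet> h"
      using mono[of h] h by (simp add: h_def inner_diff_left)
    moreover have "- (G p \<bullet> h) \<le> norm (G p) * r"
      using Cauchy_Schwarz_ineq2[of "G p" h] h by simp
    moreover have "norm (G p) * r < c * r\<^sup>2"
      using small \<open>r > 0\<close> by (simp add: power2_eq_square mult.assoc[symmetric])
    ultimately have pos: "G y \<bullet> h > 0" by linarith
    define \<phi> where "\<phi> = (\<lambda>s::real. f (y + s *\<^sub>R (- h)))"
    have "(\<phi> has_derivative (\<lambda>s. G (y + 0 *\<^sub>R (- h)) \<bullet> (s *\<^sub>R (- h)))) (at 0)"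
      unfolding \<phi>_def
      by (rule has_derivative_compose[where g=f and f="\<lambda>s. y + s *\<^sub>R (- h)" and s=UNIV, OF _ f'])
        (auto intro!: derivative_eq_intros)
    then have "DERIV \<phi> 0 :> - (G y \<bullet> h)"
      unfolding has_field_derivative_def by (rule has_derivative_eq_rhs) (simp add: fun_eq_iff)
    then obtain d where d: "d > 0" "\<And>s. 0 < s \<Longrightarrow> s < d \<Longrightarrow> \<phi> (0 + s) < \<phi> 0"
      using DERIV_neg_dec_right[of \<phi> "- (G y \<bullet> h)" 0] pos by auto
    define s where "s = min (d / 2) 1"
    have s: "0 < s" "s < d" "s \<le> 1" using d(1) by (auto simp: s_def)
    have "f (y + s *\<^sub>R (- h)) < f y" using d(2)[of s] s by (simp add: \<phi>_def)
    moreover have "y + s *\<^sub>R (- h) \<in> cball p r"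
    proof -
      have "p - (y + s *\<^sub>R (- h)) = - ((1 - s) *\<^sub>R h)" by (simp add: h_def algebra_simps)
      then have "dist p (y + s *\<^sub>R (- h)) = (1 - s) * r" using s h by (simp add: dist_norm)
      also have "\<dots> \<le> 1 * r" using s \<open>r > 0\<close> by (intro mult_right_mono) auto
      finally show ?thesis by simp
    qed
    ultimately show False using ymin by force
  qed
  then have yb: "y \<in> ball p r" using y by (auto simp: dist_norm norm_minus_commute)
  have "(\<lambda>h. G y \<bullet> h) = (\<lambda>h. 0)"
    using ymin by (intro differential_zero_maxmin[OF yb open_ball f']) auto
  then have "G y \<bullet> G y = 0" by meson
  then show ?thesis using that yb ymin by simp
qed

text \<open>If \<open>f z \<le> f y\<close>, strict convexity puts points of the segment arbitrarily
  close to \<open>y\<close> strictly below \<open>f y\<close>.\<close>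

lemma strictly_convex_on_local_minimizer_le:
  fixes f :: "'a::real_normed_vector \<Rightarrow> real"
  assumes cvx: "strictly_convex_on S f" and y: "local_minimizer_in S f y"
    and z: "z \<in> S" "z \<noteq> y"
  shows "f y < f z"
proof (rule ccontr)
  assume "\<not> f y < f z"
  then have le: "f z \<le> f y" by simp
  have yS: "y \<in> S" and "\<forall>\<^sub>F x in at y within S. f y \<le> f x"
    using y by (auto simp: local_minimizer_in_def)
  then obtain d where d: "d > 0" "\<And>x. x \<in> S \<Longrightarrow> x \<noteq> y \<Longrightarrow> dist x y < d \<Longrightarrow> f y \<le> f x"
    unfolding eventually_at by blast
  define D where "D = norm (z - y)"
  have D: "D > 0" using z(2) by (simp add: D_def)
  define s where "s = min (1/2) (d / (2 * D))"
  have s: "0 < s" "s < 1" using d(1) D by (auto simp: s_def)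
  have "s * D \<le> d / (2 * D) * D" using D by (intro mult_right_mono) (auto simp: s_def)
  also have "\<dots> < d" using D d(1) by simp
  finally have sD: "s * D < d" .
  define x where "x = (1 - s) *\<^sub>R y + s *\<^sub>R z"
  have xy: "x - y = s *\<^sub>R (z - y)" by (simp add: x_def algebra_simps)
  have "x \<in> S" unfolding x_def using cvx yS z s
    by (intro convexD) (auto simp: strictly_convex_on_def)
  moreover have "x \<noteq> y" using xy s z(2) by auto
  moreover have "dist x y < d" using xy sD s by (simp add: dist_norm D_def)
  ultimately have "f y \<le> f x" by (rule d(2))
  moreover have "f x < (1 - s) * f y + s * f z"
    using cvx yS z s unfolding strictly_convex_on_def x_def by (metis add.commute diff_add_cancel diff_gt_0_iff_gt)
  moreover have "(1 - s) * f y + s * f z \<le> (1 - s) * f y + s * f y"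
    using le s by (intro add_left_mono mult_left_mono) auto
  ultimately show False by (simp add: algebra_simps)
qed

text \<open>Evaluates the description operator in \<open>imf_map\<close> once any local minimizer
  has been exhibited.\<close>

lemma the_local_minimizer:
  fixes f :: "'a::real_normed_vector \<Rightarrow> real"
  assumes "strictly_convex_on S f" "local_minimizer_in S f y"
  shows "(THE z. local_minimizer_in S f z) = y"
proof (rule the_equality)
  fix z assume z: "local_minimizer_in S f z"
  have "y \<in> S" "z \<in> S" using z assms(2) by (auto simp: local_minimizer_in_def)
  then show "z = y"
    using strictly_convex_on_local_minimizer_le[OF assms(1) z]
      strictly_convex_on_local_minimizer_le[OF assms] by (metis less_asym)
qed (fact assms(2))

text \<open>On a small enough ball the quadratic bound implies contraction by 1/2, which keeps the
  iterates in the ball and makes them converge.\<close>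

lemma locally_quadratically_convergentI:
  fixes \<Phi> :: "'a::metric_space \<Rightarrow> 'a"
  assumes "r > 0" "ball p r \<subseteq> U" and quad: "\<And>x. dist x p < r \<Longrightarrow> dist (\<Phi> x) p \<le> C * (dist x p)\<^sup>2"
  shows "locally_quadratically_convergent \<Phi> U p"
proof -
  \<comment> \<open>No sign of \<open>C\<close> is assumed; a constant that is at least 1 makes the
    radius 1/(2 K) meaningful.\<close>
  define K where "K = max C 1"
  have K: "K > 0" by (simp add: K_def)
  define \<rho> where "\<rho> = min r (1 / (2 * K))"
  have \<rho>: "\<rho> > 0" "\<rho> \<le> r" "K * \<rho> \<le> 1 / 2"
  proof -
    show "\<rho> > 0" "\<rho> \<le> r" using K \<open>r > 0\<close> by (auto simp: \<rho>_def)
    have "K * \<rho> \<le> K * (1 / (2 * K))" using K by (intro mult_left_mono) (auto simp: \<rho>_def)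
    then show "K * \<rho> \<le> 1 / 2" using K by simp
  qed
  have half: "dist (\<Phi> x) p \<le> (1 / 2) * dist x p" if "dist x p < \<rho>" for x
  proof -
    have "dist (\<Phi> x) p \<le> C * (dist x p)\<^sup>2" using quad that \<rho> by simp
    also have "\<dots> \<le> K * (dist x p)\<^sup>2" by (intro mult_right_mono) (auto simp: K_def)
    also have "\<dots> = (K * dist x p) * dist x p" by (simp add: power2_eq_square)
    also have "\<dots> \<le> (K * \<rho>) * dist x p"
      using K that by (intro mult_right_mono mult_left_mono) auto
    also have "\<dots> \<le> (1 / 2) * dist x p" using \<rho>(3) by (intro mult_right_mono) auto
    finally show ?thesis .
  qed
  have iter: "dist ((\<Phi> ^^ k) x) p \<le> (1 / 2) ^ k * dist x p \<and> dist ((\<Phi> ^^ k) x) p < \<rho>" if x: "dist x p < \<rho>" for x k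
  proof (induction k)
    case (Suc k)
    have "dist ((\<Phi> ^^ Suc k) x) p \<le> (1 / 2) * dist ((\<Phi> ^^ k) x) p" using half Suc by simp
    moreover have "(1 / 2) * dist ((\<Phi> ^^ k) x) p \<le> (1 / 2) * ((1 / 2) ^ k * dist x p)" using Suc by simp
    moreover have "(1 / 2) * dist ((\<Phi> ^^ k) x) p < \<rho>" using Suc zero_le_dist[of "(\<Phi> ^^ k) x" p] by linarith
    ultimately show ?case by simp
  qed (use x in simp)
  show ?thesis unfolding locally_quadratically_convergent_def
  proof (rule exI[of _ \<rho>], intro exI[of _ C] conjI ballI allI)
    show "ball p \<rho> \<subseteq> U" using assms(2) \<rho>(2) by (meson order_trans subset_ball)
    fix x assume "x \<in> ball p \<rho>"
    then have x: "dist x p < \<rho>" by (simp add: dist_commute)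
    show "(\<Phi> ^^ k) x \<in> U" for k
      using iter[OF x, of k] assms(2) \<rho>(2) by (auto simp: dist_commute)
    show "dist ((\<Phi> ^^ Suc k) x) p \<le> C * (dist ((\<Phi> ^^ k) x) p)\<^sup>2" for k
      using quad iter[OF x, of k] \<rho>(2) by simp
    have "(\<lambda>k. (1 / 2) ^ k * dist x p) \<longlonglongrightarrow> 0"
      by (intro tendsto_mult_left_zero LIMSEQ_power_zero) simp
    then have "(\<lambda>k. dist ((\<Phi> ^^ k) x) p) \<longlonglongrightarrow> 0"
      by (rule Lim_null_comparison[rotated]) (use iter[OF x] in auto)
    then show "(\<lambda>k. (\<Phi> ^^ k) x) \<longlonglongrightarrow> p" by (rule tendsto_dist_iff[THEN iffD2])
  qed (fact \<rho>(1))
qed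

text \<open>At the minimizer \<open>F x\<close> is 0, so its increment from \<open>p\<close> is
  \<open>- F x p\<close>: strong monotonicity gives the lower comparison with the distance and the
  Lipschitz bound the upper one. Both are exported because sharpness of the rate depends on the
  second.\<close>

lemma (in saddle_data) minimizer_map_estimate:
  fixes L :: "real^'n \<Rightarrow> real^'n \<Rightarrow> real"
  assumes L': "\<And>x y. (L x has_derivative (\<lambda>h. F x y \<bullet> h)) (at y)"
    and U: "p \<in> interior U" and cvx: "\<And>x. x \<in> U \<Longrightarrow> strictly_convex_on U (L x)"
  defines "\<Phi> \<equiv> \<lambda>x. THE y. local_minimizer_in U (L x) y"
  obtains r C c M where "r > 0" "ball p r \<subseteq> U" "c > 0" "M > 0"
    "\<And>x. dist x p < r \<Longrightarrow> dist (\<Phi> x) p \<le> C * (dist x p)\<^sup>2"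
    "\<And>x. dist x p < r \<Longrightarrow> c * dist (\<Phi> x) p \<le> norm (F x p)"
    "\<And>x. dist x p < r \<Longrightarrow> norm (F x p) \<le> M * dist (\<Phi> x) p"
proof -
  obtain c r1 where c: "c > 0" "r1 > 0"
    "\<And>x h. norm (x - p) < r1 \<Longrightarrow> norm h < r1 \<Longrightarrow> c * (norm h)\<^sup>2 \<le> (F x (p + h) - F x p) \<bullet> h"
    using F_strongly_monotone by blast
  obtain M r2 where M: "M > 0" "r2 > 0"
    "\<And>x h. norm (x - p) < r2 \<Longrightarrow> norm h < r2 \<Longrightarrow> norm (F x (p + h) - F x p) \<le> M * norm h"
    using F_lipschitz by blast
  obtain C r3 where C: "C > 0" "r3 > 0" "\<And>x. dist x p < r3 \<Longrightarrow> norm (F x p) \<le> C * (dist x p)\<^sup>2"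
    using residual_quadratic by blast
  obtain r4 where r4: "r4 > 0" "ball p r4 \<subseteq> U"
    using U by (auto simp: mem_interior)
  \<comment> \<open>Halved so that the closed ball of radius \<open>R\<close> stays strictly within
    all three radii.\<close>
  define R where "R = min r1 (min r2 r4) / 2"
  have R: "R > 0" "R < r1" "R < r2" "R < r4" using c(2) M(2) r4(1) by (auto simp: R_def)
  \<comment> \<open>The bound 1 reduces C dist^2 to C dist, and c R / C brings this below c R, the
    smallness that \<open>interior_minimizer\<close> requires.\<close>
  define r where "r = min (min R r3) (min 1 (c * R / C))"
  have cRC: "c * R / C > 0" using R c C by simp
  have r: "r > 0" "r \<le> R" "r \<le> r3" "r \<le> 1" "r \<le> c * R / C"
    using R(1) C(2) cRC by (auto simp: r_def)
  have RU: "cball p R \<subseteq> U" using R(4) r4(2) by auto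
  have main: "c * dist (\<Phi> x) p \<le> norm (F x p) \<and> norm (F x p) \<le> M * dist (\<Phi> x) p" if x: "dist x p < r" for x
  proof -
    have xU: "x \<in> U" using x r(2) RU by (auto simp: dist_commute)
    have small: "norm (F x p) < c * R"
    proof (cases "x = p")
      case True
      then show ?thesis using c(1) R(1) by (simp add: F_p_p)
    next
      case False
      have "norm (F x p) \<le> C * (dist x p)\<^sup>2" using C(3) x r by simp
      also have "\<dots> \<le> C * (dist x p * 1)"
        unfolding power2_eq_square using x r(4) C(1) by (intro mult_left_mono) auto
      also have "\<dots> < C * (c * R / C)"
      proof -
        have "dist x p < c * R / C" using x r(5) by linarith
        then show ?thesis using C(1) by (intro mult_strict_left_mono) auto
      qed
      also have "\<dots> = c * R" using C(1) by simp
      finally show ?thesis .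
    qed
    have mono: "c * (norm h)\<^sup>2 \<le> (F x (p + h) - F x p) \<bullet> h" if "norm h \<le> R" for h
      using that x r(2) R by (intro c(3)) (auto simp: dist_norm)
    obtain y where y: "y \<in> ball p R" "F x y = 0" "\<And>z. z \<in> cball p R \<Longrightarrow> L x y \<le> L x z"
      using interior_minimizer[OF L' R(1) mono small] by blast
    \<comment> \<open>The minimum over the ball is a local one in \<open>U\<close>, as
      \<open>y\<close> lies in the open ball; strict convexity on \<open>U\<close> identifies it
      with the value of the map.\<close>
    have "\<forall>\<^sub>F z in at y within U. z \<in> ball p R"
      using y(1) by (meson eventually_at_topological open_ball)
    then have "\<forall>\<^sub>F z in at y within U. L x y \<le> L x z"
      by (rule eventually_mono) (use y(3) in auto)
    then have "local_minimizer_in U (L x) y" using y(1) RU by (auto simp: local_minimizer_in_def)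
    then have \<Phi>: "\<Phi> x = y" unfolding \<Phi>_def by (rule the_local_minimizer[OF cvx[OF xU]])
    define h where "h = y - p"
    have h: "norm h < R" "p + h = y" "norm h = dist y p"
      using y(1) by (auto simp: h_def dist_norm norm_minus_commute)
    have "c * (norm h)\<^sup>2 \<le> - (F x p \<bullet> h)" using mono[of h] h y(2) by (simp add: inner_diff_left)
    also have "\<dots> \<le> norm (F x p) * norm h" using Cauchy_Schwarz_ineq2[of "F x p" h] by linarith
    finally have 1: "(c * norm h) * norm h \<le> norm (F x p) * norm h" by (simp add: power2_eq_square mult.assoc)
    have "c * norm h \<le> norm (F x p)"
    proof (cases "h = 0")
      case False
      then show ?thesis using 1 by (simp add: mult_le_cancel_right)
    qed simp
    moreover have "norm (F x p) \<le> M * norm h"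
      using M(3)[of x h] x r(2) R h y(2) by (simp add: dist_norm)
    ultimately show ?thesis using h(3) \<Phi> by simp
  qed
  show ?thesis
  proof (rule that[of r c M "C / c"])
    show "ball p r \<subseteq> U" using r(2) RU by auto
    show "dist (\<Phi> x) p \<le> C / c * (dist x p)\<^sup>2" if "dist x p < r" for x
    proof -
      have "c * dist (\<Phi> x) p \<le> C * (dist x p)\<^sup>2" using main[OF that] C(3)[of x] that r(3) by force
      then show ?thesis using c(1) by (simp add: pos_le_divide_eq mult.commute)
    qed
  qed (use main r(1) c(1) M(1) in auto)
qed

lemma (in saddle_data) minimizer_map_convergence:
  fixes L :: "real^'n \<Rightarrow> real^'n \<Rightarrow> real"
  assumes L': "\<And>x y. (L x has_derivative (\<lambda>h. F x y \<bullet> h)) (at y)"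
    and U: "p \<in> interior U" and cvx: "\<And>x. x \<in> U \<Longrightarrow> strictly_convex_on U (L x)"
  defines "\<Phi> \<equiv> \<lambda>x. THE y. local_minimizer_in U (L x) y"
  shows "locally_quadratically_convergent \<Phi> U p"
    and "(\<lambda>x. dist (\<Phi> x) p) \<in> o[at p](\<lambda>x. (dist x p)\<^sup>2) \<longleftrightarrow>
          (\<forall>u w. w \<bullet> v p = 0 \<longrightarrow> w \<bullet> (T u *v v p) = 0)"
proof -
  obtain r C c M where r: "r > 0" "ball p r \<subseteq> U" and cM: "c > 0" "M > 0"
    and quad: "\<And>x. dist x p < r \<Longrightarrow> dist (\<Phi> x) p \<le> C * (dist x p)\<^sup>2"
    and lower: "\<And>x. dist x p < r \<Longrightarrow> c * dist (\<Phi> x) p \<le> norm (F x p)"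
    and upper: "\<And>x. dist x p < r \<Longrightarrow> norm (F x p) \<le> M * dist (\<Phi> x) p"
    unfolding \<Phi>_def using minimizer_map_estimate[OF L' U cvx] by metis
  show "locally_quadratically_convergent \<Phi> U p"
    by (rule locally_quadratically_convergentI[OF r quad])
  have near: "\<forall>\<^sub>F x in at p. dist x p < r"
    using r(1) by (auto simp: eventually_at)
  have "(\<lambda>x. dist (\<Phi> x) p) \<in> o[at p](\<lambda>x. (dist x p)\<^sup>2) \<longleftrightarrow>
      (\<forall>\<epsilon>>0. \<forall>\<^sub>F x in at p. dist (\<Phi> x) p \<le> \<epsilon> * (dist x p)\<^sup>2)"
    by (simp add: smallo_def)
  also have "\<dots> \<longleftrightarrow> (\<forall>\<epsilon>>0. \<forall>\<^sub>F x in at p. norm (F x p) \<le> \<epsilon> * (dist x p)\<^sup>2)"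
  proof (intro iffI allI impI)
    fix \<epsilon> :: real assume "\<epsilon> > 0" and o: "\<forall>\<epsilon>>0. \<forall>\<^sub>F x in at p. dist (\<Phi> x) p \<le> \<epsilon> * (dist x p)\<^sup>2"
    have "\<forall>\<^sub>F x in at p. dist (\<Phi> x) p \<le> \<epsilon> / M * (dist x p)\<^sup>2" by (rule o[rule_format]) (use \<open>\<epsilon> > 0\<close> cM in simp)
    with near show "\<forall>\<^sub>F x in at p. norm (F x p) \<le> \<epsilon> * (dist x p)\<^sup>2"
    proof eventually_elim
      case (elim x)
      have "norm (F x p) \<le> M * dist (\<Phi> x) p" using upper elim by blast
      also have "\<dots> \<le> M * (\<epsilon> / M * (dist x p)\<^sup>2)" using elim cM by (intro mult_left_mono) auto
      also have "\<dots> = \<epsilon> * (dist x p)\<^sup>2" using cM by simp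
      finally show ?case .
    qed
  next
    fix \<epsilon> :: real assume "\<epsilon> > 0" and o: "\<forall>\<epsilon>>0. \<forall>\<^sub>F x in at p. norm (F x p) \<le> \<epsilon> * (dist x p)\<^sup>2"
    have "\<forall>\<^sub>F x in at p. norm (F x p) \<le> (c * \<epsilon>) * (dist x p)\<^sup>2" by (rule o[rule_format]) (use \<open>\<epsilon> > 0\<close> cM in simp)
    with near show "\<forall>\<^sub>F x in at p. dist (\<Phi> x) p \<le> \<epsilon> * (dist x p)\<^sup>2"
    proof eventually_elim
      case (elim x)
      have "c * dist (\<Phi> x) p \<le> c * (\<epsilon> * (dist x p)\<^sup>2)" using lower[of x] elim by (simp add: mult.assoc)
      then show ?case using cM by (simp only: mult_le_cancel_left_pos)
    qed
  qed
  also have "\<dots> \<longleftrightarrow> (\<forall>u w. w \<bullet> v p = 0 \<longrightarrow> w \<bullet> (T u *v v p) = 0)"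
    unfolding residual_little_o_iff Q_eq_0_iff ..
  finally show "(\<lambda>x. dist (\<Phi> x) p) \<in> o[at p](\<lambda>x. (dist x p)\<^sup>2) \<longleftrightarrow>
          (\<forall>u w. w \<bullet> v p = 0 \<longrightarrow> w \<bullet> (T u *v v p) = 0)" .
qed

subsection \<open>The scheme near an index-1 saddle point\<close>

text \<open>Chain rule; the projections are self-adjoint and so move from the increment
  \<open>h\<close> to the gradients.\<close>

lemma has_derivative_aux_L:
  assumes V': "\<And>y. (V has_derivative (\<lambda>h. g y \<bullet> h)) (at y)"
  shows "(aux_L V v \<alpha> \<beta> x has_derivative (\<lambda>h.
      ((1 - \<alpha>) *\<^sub>R g y
       + \<alpha> *\<^sub>R (g (y - line_proj (v x) (y - x)) - line_proj (v x) (g (y - line_proj (v x) (y - x))))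
       - \<beta> *\<^sub>R line_proj (v x) (g (x + line_proj (v x) (y - x)))) \<bullet> h)) (at y)"
proof -
  define e where "e = v x"
  define a where "a = (\<lambda>y. y - line_proj e (y - x))"
  define b where "b = (\<lambda>y. x + line_proj e (y - x))"
  have a': "(a has_derivative (\<lambda>h. h - line_proj e h)) (at y)"
    and b': "(b has_derivative (\<lambda>h. line_proj e h)) (at y)"
    unfolding a_def b_def line_proj_def by (auto intro!: derivative_eq_intros)
  have L: "aux_L V v \<alpha> \<beta> x = (\<lambda>y. (1 - \<alpha>) * V y + \<alpha> * V (a y) - \<beta> * V (b y))"
    by (simp add: fun_eq_iff aux_L_def a_def b_def e_def line_proj_def)
  have "((\<lambda>y. (1 - \<alpha>) * V y + \<alpha> * V (a y) - \<beta> * V (b y)) has_derivative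
      (\<lambda>h. (1 - \<alpha>) * (g y \<bullet> h) + \<alpha> * (g (a y) \<bullet> (h - line_proj e h)) - \<beta> * (g (b y) \<bullet> line_proj e h))) (at y)"
    by (intro has_derivative_diff has_derivative_add has_derivative_mult_right V'
        has_derivative_compose[OF a' V'] has_derivative_compose[OF b' V'])
  then show ?thesis
    unfolding L e_def[symmetric] a_def[symmetric, THEN fun_cong] b_def[symmetric, THEN fun_cong]
    by (rule has_derivative_eq_rhs)
      (simp add: fun_eq_iff line_proj_def inner_add_left inner_diff_left inner_diff_right inner_commute
        algebra_simps)
qed

text \<open>Let \<open>w\<close> be the part of \<open>v x\<close> orthogonal to \<open>v p\<close>.
  The Rayleigh quotient of \<open>v x\<close> for \<open>H p\<close> exceeds \<open>l\<close> by at
  least (m - l) |w|^2, whereas minimality for \<open>H x\<close> bounds the excess by a multiple of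
  |H x - H p|. The sign condition rules out \<open>v x\<close> near \<open>- v p\<close>.\<close>

lemma isCont_min_mode:
  fixes H :: "real^'n \<Rightarrow> real^'n^'n"
  assumes H: "isCont H p" and sym: "\<And>h k. (H p *v h) \<bullet> k = h \<bullet> (H p *v k)"
    and norm_v: "\<And>x. norm (v x) = 1"
    and min: "\<And>x z. norm z = 1 \<Longrightarrow> v x \<bullet> (H x *v v x) \<le> z \<bullet> (H x *v z)"
    and eigen: "H p *v v p = l *\<^sub>R v p"
    and coercive: "\<And>w. w \<bullet> v p = 0 \<Longrightarrow> m * (norm w)\<^sup>2 \<le> w \<bullet> (H p *v w)"
    and lm: "l < m" and sign: "\<And>x. v x \<bullet> v p \<ge> 0"
  shows "isCont v p"
proof -
  obtain K where K: "K > 0" "\<And>(A::real^'n^'n) x. norm (A *v x) \<le> norm A * norm x * K"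
    using norm_matrix_vector_mult_le by blast
  have vv: "v x \<bullet> v x = 1" for x using norm_v by (simp add: norm_eq_1)
  have bound: "(norm (v x - v p))\<^sup>2 \<le> 4 * K / (m - l) * norm (H x - H p)" for x
  proof -
    define a where "a = v x \<bullet> v p"
    define w where "w = v x - a *\<^sub>R v p"
    have vx: "v x = a *\<^sub>R v p + w" by (simp add: w_def)
    have wp: "w \<bullet> v p = 0" by (simp add: w_def inner_diff_left vv a_def)
    have wHp: "v p \<bullet> (H p *v w) = 0" "w \<bullet> (H p *v v p) = 0"
      using sym[of "v p" w] by (simp_all add: eigen wp inner_commute)
    have one: "1 = a\<^sup>2 + w \<bullet> w"
      using vv[of x] wp by (simp add: vx inner_add_left inner_add_right inner_commute vv power2_eq_square)
    have q: "v x \<bullet> (H p *v v x) = a\<^sup>2 * l + w \<bullet> (H p *v w)"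
      by (simp add: vx matrix_vector_right_distrib matrix_vector_mult_scaleR inner_add_left inner_add_right
          eigen wp wHp vv power2_eq_square inner_commute[of "v p" w])
    have diff: "\<bar>z \<bullet> (H x *v z) - z \<bullet> (H p *v z)\<bar> \<le> K * norm (H x - H p)" if "norm z = 1" for z
    proof -
      have "\<bar>z \<bullet> ((H x - H p) *v z)\<bar> \<le> norm z * norm ((H x - H p) *v z)" by (rule Cauchy_Schwarz_ineq2)
      also have "\<dots> \<le> K * norm (H x - H p)" using K(2)[of "H x - H p" z] that by (simp add: mult.commute)
      finally show ?thesis by (simp add: matrix_vector_mult_diff_rdistrib inner_diff_right)
    qed
    have "a\<^sup>2 * l + m * (w \<bullet> w) \<le> v x \<bullet> (H p *v v x)"
      using coercive[OF wp] by (simp add: q power2_norm_eq_inner)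
    also have "\<dots> \<le> v x \<bullet> (H x *v v x) + K * norm (H x - H p)" using diff[OF norm_v[of x]] by linarith
    also have "\<dots> \<le> v p \<bullet> (H x *v v p) + K * norm (H x - H p)" using min[OF norm_v] by simp
    also have "\<dots> \<le> l + 2 * (K * norm (H x - H p))" using diff[OF norm_v[of p]] by (simp add: eigen vv)
    finally have "a\<^sup>2 * l + m * (w \<bullet> w) \<le> l + 2 * (K * norm (H x - H p))" .
    moreover have "a\<^sup>2 * l = l - l * (w \<bullet> w)"
    proof -
      have "a\<^sup>2 = 1 - w \<bullet> w" using one by linarith
      then show ?thesis by (simp add: left_diff_distrib right_diff_distrib mult.commute)
    qed
    ultimately have "(m - l) * (w \<bullet> w) \<le> 2 * (K * norm (H x - H p))"
      unfolding left_diff_distrib by linarith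
    then have ww: "w \<bullet> w \<le> 2 * (K * norm (H x - H p)) / (m - l)"
      using lm by (simp add: pos_le_divide_eq mult.commute)
    have "a\<^sup>2 \<le> 1" using one inner_ge_zero[of w] by linarith
    then have "a \<le> 1" using power2_le_imp_le[of a 1] by simp
    \<comment> \<open>As 0 \<le> a \<le> 1, the squared distance 2 - 2 a is at most 2 (1 - a^2),
      which is 2 (w \<bullet> w).\<close>
    then have "a\<^sup>2 \<le> a" using sign[of x] by (simp add: power2_eq_square mult_left_le flip: a_def)
    moreover have "(norm (v x - v p))\<^sup>2 = 2 - 2 * a"
      unfolding power2_norm_eq_inner
      by (simp add: inner_diff_left inner_diff_right vv a_def inner_commute)
    ultimately have "(norm (v x - v p))\<^sup>2 \<le> 2 * (w \<bullet> w)" using one by linarith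
    also have "\<dots> \<le> 2 * (2 * (K * norm (H x - H p)) / (m - l))" using ww by simp
    finally show ?thesis by (simp add: mult.assoc)
  qed
  have "(\<lambda>x. sqrt (4 * K / (m - l) * norm (H x - H p))) \<midarrow>p\<rightarrow> sqrt (4 * K / (m - l) * 0)"
    using H unfolding isCont_def by (intro tendsto_intros tendsto_norm_zero LIM_zero)
  then have "(\<lambda>x. sqrt (4 * K / (m - l) * norm (H x - H p))) \<midarrow>p\<rightarrow> 0" by simp
  then have "(\<lambda>x. v x - v p) \<midarrow>p\<rightarrow> 0"
    by (rule Lim_null_comparison[rotated])
      (intro always_eventually allI real_le_rsqrt bound)
  then show ?thesis unfolding isCont_def by (rule LIM_zero_cancel)
qed

theorem corollary2:
  fixes V :: "real^'n \<Rightarrow> real"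
    and v :: "real^'n \<Rightarrow> real^'n"
    and xs :: "real^'n"
    and \<alpha> \<beta> :: real
    and U :: "(real^'n) set"
  assumes "C_k 4 V"
    and "index1_saddle V xs"
    and "\<alpha> + \<beta> > 1"
    and "min_mode_field V v"
    and "admissible_nbhd V v \<alpha> \<beta> xs U"
  shows "locally_quadratically_convergent (imf_map V v \<alpha> \<beta> U) U xs \<and>
         (exactly_second_order (imf_map V v \<alpha> \<beta> U) U xs \<longleftrightarrow> nondegenerate_mode V v xs)"
proof -
  have C4: "C_k (Suc (Suc (Suc (Suc 0)))) V" using assms(1) by (simp add: numeral_eq_Suc del: C_k.simps)
  define T where "T = frechet_derivative (hessian V) (at xs)"
  have H': "(hessian V has_derivative T) (at xs)"
    unfolding T_def using hessian_differentiable[OF C4] by (simp add: frechet_derivative_works)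
  have V': "(V has_derivative (\<lambda>h. gradient V y \<bullet> h)) (at y)" for y
    by (rule has_derivative_gradient[OF C_k_Suc_imp_differentiable[OF C4]])
  note sym = hessian_symmetric[OF C4]
  \<comment> \<open>Only \<open>v x\<close> up to sign enters the scheme, and this choice of sign makes it continuous at \<open>xs\<close>.\<close>
  define v' where "v' = (\<lambda>x. if v x \<bullet> v xs \<ge> 0 then v x else - v x)"
  have v': "v' x = v x \<or> v' x = - v x" for x by (simp add: v'_def)
  have neg: "A *v (- z) = - (A *v z)" for A :: "real^'n^'n" and z
    using matrix_vector_mult_scaleR[of A "-1" z] by simp
  have L_eq: "aux_L V v' \<alpha> \<beta> = aux_L V v \<alpha> \<beta>"
  proof (intro ext)
    show "aux_L V v' \<alpha> \<beta> x y = aux_L V v \<alpha> \<beta> x y" for x y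
      using v'[of x] by (auto simp: aux_L_def)
  qed
  have min: "norm (v' x) = 1" "norm z = 1 \<Longrightarrow> v' x \<bullet> (hessian V x *v v' x) \<le> z \<bullet> (hessian V x *v z)" for x z
    using assms(4) v'[of x] unfolding min_mode_field_def is_arg_min_linorder by (auto simp: neg)
  \<comment> \<open>The sign at \<open>xs\<close> is kept, so the nondegeneracy condition reads the
    same for both fields.\<close>
  have v'xs: "v' xs = v xs" by (simp add: v'_def)
  have sign: "v' x \<bullet> v' xs \<ge> 0" for x by (simp add: v'xs) (simp add: v'_def)
  \<comment> \<open>Required at every point, because the residual expansion uses the eigenvector
    relation at the iterate and not at the saddle.\<close>
  have eigen: "hessian V x *v v' x = (v' x \<bullet> (hessian V x *v v' x)) *\<^sub>R v' x" for x
    by (rule rayleigh_minimizer_eigenvector[OF sym, of UNIV]) (use min in auto)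
  obtain l where l: "l < 0" "eigenvalue (hessian V xs) l" "dim (eigenspace (hessian V xs) l) = 1"
      "\<And>m. eigenvalue (hessian V xs) m \<Longrightarrow> m \<noteq> l \<Longrightarrow> m > 0"
    and crit: "gradient V xs = 0"
    using assms(2) unfolding index1_saddle_def by blast
  have argmin: "is_arg_min (\<lambda>u. u \<bullet> (hessian V xs *v u)) (\<lambda>u. norm u = 1) (v' xs)"
    using min by (simp add: is_arg_min_linorder)
  have ev: "hessian V xs *v v' xs = l *\<^sub>R v' xs"
    by (rule minimal_eigenvalue_structure(1)[OF sym argmin l])
  obtain m where m: "m > 0" "\<And>w. w \<bullet> v' xs = 0 \<Longrightarrow> m * (norm w)\<^sup>2 \<le> w \<bullet> (hessian V xs *v w)"
    using minimal_eigenvalue_structure(2)[OF sym argmin l] by blast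
  have v_cont: "isCont v' xs"
    by (rule isCont_min_mode[OF has_derivative_continuous[OF H'] sym min(1) min(2) ev m(2) _ sign])
      (use l(1) m(1) in auto)
  interpret saddle_data "gradient V" "hessian V" T xs v' \<alpha> \<beta> m "\<lambda>x. v' x \<bullet> (hessian V x *v v' x)"
  proof
    show "v' xs \<bullet> (hessian V xs *v v' xs) < 0"
      using min(1) l(1) by (simp add: ev norm_eq_1)
  qed (use has_derivative_hessian[OF C4] H' hessian_derivative_symmetric[OF assms(1) H'] sym crit
      min eigen m v_cont assms(3) in auto)
  have U: "xs \<in> interior U" "\<And>x. x \<in> U \<Longrightarrow> strictly_convex_on U (aux_L V v' \<alpha> \<beta> x)"
    using assms(5) by (auto simp: admissible_nbhd_def L_eq)
  have L': "(aux_L V v' \<alpha> \<beta> x has_derivative (\<lambda>h. F x y \<bullet> h)) (at y)" for x y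
    unfolding F_def by (rule has_derivative_aux_L[OF V'])
  have \<Phi>: "imf_map V v \<alpha> \<beta> U = (\<lambda>x. THE y. local_minimizer_in U (aux_L V v' \<alpha> \<beta> x) y)"
    by (simp add: fun_eq_iff imf_map_def L_eq)
  show ?thesis
    using minimizer_map_convergence[OF L' U]
    unfolding \<Phi> exactly_second_order_def nondegenerate_mode_def T_def[symmetric] v'xs by blast
qed

end
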